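(* Let $U=\sum_{\vec q\in Q}A_{\vec q}S_{\vec q}$ be the evolution operator of a massless quantum walk on $\mathbb{Z}^d$ with coin space $\mathcal{H}_C$, i.e. $\mathcal{H}_C$ is finite-dimensional, $Q\subset\mathbb{Z}^d$ is finite, the $A_{\vec q}$ are operators on $\mathcal{H}_C$, $U$ is unitary, and $\sum_{\vec q\in Q}A_{\vec q}=\mathbb{I}$. Then in the continuum limit this corresponds to evolution via the Hamiltonian $$H=\sum_{\vec q\in Q}A_{\vec q}\,(\vec q\cdot\vec P).$$ That is, for every fixed $t>0$, with $N=t/a$ an integer, and every momentum cutoff $\Lambda=\Lambda(a)$ with $\Lambda\to\infty$ and $\Lambda^2a\to0$ as $a\to0$, $$\left\|e^{-iHt}-U^{N}\right\|_{\Lambda}\to0\quad\text{as }a\to0.$$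
   Context: A quantum walk on $\mathbb{Z}^d$ has Hilbert space $\mathcal{H}_C\otimes\mathcal{H}_P$, where $\mathcal{H}_P$ has orthonormal basis $|\vec n\rangle$, $\vec n\in\mathbb{Z}^d$; $S_{\vec q}|\vec n\rangle=|\vec n+\vec q\rangle$. Every translationally invariant causal unitary has the form $\sum_{\vec q\in Q}A_{\vec q}S_{\vec q}$ with $Q$ finite; then $\sum_{\vec q}A_{\vec q}$ is unitary, and the walk is called massless if this unitary is $\mathbb{I}$. The lattice spacing and the duration of one timestep are both $a>0$. To take the continuum limit, the walk is embedded in the continuum space $\mathcal{H}_C\otimes L^2(\mathbb{R}^d)$: the shift $S_{\vec q}$ becomes $e^{-i\vec q\cdot\vec P a}$, where $\vec P=(P_1,\dots,P_d)$, $P_b=-i\partial_{x_b}$, is the continuum momentum operator, so $U=\sum_{\vec q}A_{\vec q}e^{-i\vec q\cdot\vec P a}$. $\|\cdot\|_\Lambda$ is the operator norm restricted to the subspace of states whose momentum components all satisfy $|p_b|\le\Lambda$. *)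

theory Defs
  imports "HOL-Analysis.Analysis"
begin

text \<open>The coin space is \<open>\<complex>\<^sup>c\<close> with its standard inner product (\<open>norm\<close> on \<open>complex ^ 'c\<close> is the
  induced norm).\<close>

definition coin_inner :: "complex ^ 'c \<Rightarrow> complex ^ 'c \<Rightarrow> complex" where
  "coin_inner u v = (\<Sum>i\<in>UNIV. cnj (u $ i) * v $ i)"

section \<open>The walk on the lattice\<close>

definition lattice_states :: "(int ^ 'd \<Rightarrow> complex ^ 'c) set" where
  "lattice_states = {\<phi>. (\<lambda>n. (norm (\<phi> n))\<^sup>2) summable_on UNIV}"

definition lattice_inner :: "(int ^ 'd \<Rightarrow> complex ^ 'c) \<Rightarrow> (int ^ 'd \<Rightarrow> complex ^ 'c) \<Rightarrow> complex" where
  "lattice_inner \<phi> \<eta> = (\<Sum>\<^sub>\<infinity>n. coin_inner (\<phi> n) (\<eta> n))"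

definition lattice_shift ::
    "int ^ 'd \<Rightarrow> (int ^ 'd \<Rightarrow> complex ^ 'c) \<Rightarrow> int ^ 'd \<Rightarrow> complex ^ 'c" where
  "lattice_shift q \<phi> = (\<lambda>n. \<phi> (n - q))"

definition lattice_walk ::
    "(int ^ 'd) set \<Rightarrow> (int ^ 'd \<Rightarrow> complex ^ 'c ^ 'c)
      \<Rightarrow> (int ^ 'd \<Rightarrow> complex ^ 'c) \<Rightarrow> int ^ 'd \<Rightarrow> complex ^ 'c" where
  "lattice_walk Q A \<phi> = (\<lambda>n. \<Sum>q\<in>Q. A q *v lattice_shift q \<phi> n)"

text \<open>Used only for operators that are linear by construction, for which this is unitarity.\<close>

definition lattice_unitary ::
    "((int ^ 'd \<Rightarrow> complex ^ 'c) \<Rightarrow> (int ^ 'd \<Rightarrow> complex ^ 'c)) \<Rightarrow> bool" where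
  "lattice_unitary W \<longleftrightarrow>
     W ` lattice_states = lattice_states \<and>
     (\<forall>\<phi>\<in>lattice_states. \<forall>\<eta>\<in>lattice_states. lattice_inner (W \<phi>) (W \<eta>) = lattice_inner \<phi> \<eta>)"

definition massless_walk :: "(int ^ 'd) set \<Rightarrow> (int ^ 'd \<Rightarrow> complex ^ 'c ^ 'c) \<Rightarrow> bool" where
  "massless_walk Q A \<longleftrightarrow>
     finite Q \<and> lattice_unitary (lattice_walk Q A) \<and> (\<Sum>q\<in>Q. A q) = mat 1"

section \<open>Continuum states and the momentum cutoff\<close>

type_synonym ('d, 'c) wavefun = "real ^ 'd \<Rightarrow> complex ^ 'c"

text \<open>The \<open>L\<^sup>2\<close> norm takes values in \<^typ>\<open>ennreal\<close>, so it is infinite, rather than a default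
  value, for functions that are not square integrable.\<close>

definition L2_norm :: "('d::finite, 'c::finite) wavefun \<Rightarrow> ennreal" where
  "L2_norm \<psi> =
     (let I = \<integral>\<^sup>+ x. ennreal ((norm (\<psi> x))\<^sup>2) \<partial>lborel
      in if I = \<infinity> then \<infinity> else ennreal (sqrt (enn2real I)))"

definition L2_states :: "('d::finite, 'c::finite) wavefun set" where
  "L2_states = {\<psi>. \<psi> \<in> borel_measurable lborel \<and> L2_norm \<psi> < \<infinity>}"

definition plane_wave_superposition :: "('d::finite, 'c::finite) wavefun \<Rightarrow> ('d, 'c) wavefun" where
  "plane_wave_superposition g = (\<lambda>x.
     LINT p|lborel. (of_real ((2 * pi) powr (- real CARD('d) / 2)) * cis (p \<bullet> x)) *s g p)"

text \<open>The states whose momentum components all satisfy \<open>\<bar>p\<^sub>b\<bar> \<le> \<Lambda>\<close>: those with a momentum-space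
  wave function \<open>g\<close> vanishing outside that box. Such a \<open>g\<close> is integrable, so the integral is an
  ordinary one. Each \<open>L\<^sup>2\<close> class with this property contains exactly one function of this set, its
  smooth representative, so partial derivatives may be taken pointwise below.\<close>

definition cutoff_states :: "real \<Rightarrow> ('d::finite, 'c::finite) wavefun set" where
  "cutoff_states \<Lambda> = {\<psi> \<in> L2_states.
     \<exists>g\<in>L2_states. (\<forall>p. g p \<noteq> 0 \<longrightarrow> (\<forall>b. \<bar>p $ b\<bar> \<le> \<Lambda>)) \<and> \<psi> = plane_wave_superposition g}"

definition cutoff_norm ::
    "real \<Rightarrow> (('d::finite, 'c::finite) wavefun \<Rightarrow> ('d, 'c) wavefun) \<Rightarrow> ennreal" where
  "cutoff_norm \<Lambda> T = (SUP \<psi>\<in>{\<psi> \<in> cutoff_states \<Lambda>. L2_norm \<psi> \<le> 1}. L2_norm (T \<psi>))"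

section \<open>Momentum operators, the walk in the continuum, and the Hamiltonian\<close>

definition momentum :: "'d \<Rightarrow> ('d::finite, 'c::finite) wavefun \<Rightarrow> ('d, 'c) wavefun" where
  "momentum b \<psi> = (\<lambda>x. (- \<i>) *s vector_derivative (\<lambda>s. \<psi> (x + s *\<^sub>R axis b 1)) (at 0))"

definition dot_momentum ::
    "int ^ 'd \<Rightarrow> ('d::finite, 'c::finite) wavefun \<Rightarrow> ('d, 'c) wavefun" where
  "dot_momentum q \<psi> = (\<lambda>x. \<Sum>b\<in>UNIV. of_int (q $ b) *s momentum b \<psi> x)"

text \<open>\<open>op_exp z T\<close> is \<open>e\<^bsup>zT\<^esup>\<close>, by its power series. It is applied only to \<open>q \<cdot> P\<close> and to the Hamiltonian
  on \<open>cutoff_states \<Lambda>\<close>, an invariant subspace on which they are bounded; there the series converges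
  in \<open>L\<^sup>2\<close> as well as pointwise, with the same sum.\<close>

definition op_exp ::
    "complex \<Rightarrow> (('d::finite, 'c::finite) wavefun \<Rightarrow> ('d, 'c) wavefun) \<Rightarrow> ('d, 'c) wavefun \<Rightarrow> ('d, 'c) wavefun" where
  "op_exp z T \<psi> = (\<lambda>x. \<Sum>n. (z ^ n / fact n) *s (T ^^ n) \<psi> x)"

definition continuum_walk ::
    "(int ^ 'd) set \<Rightarrow> (int ^ 'd \<Rightarrow> complex ^ 'c ^ 'c) \<Rightarrow> real
      \<Rightarrow> ('d::finite, 'c::finite) wavefun \<Rightarrow> ('d, 'c) wavefun" where
  "continuum_walk Q A a \<psi> =
     (\<lambda>x. \<Sum>q\<in>Q. A q *v op_exp (- \<i> * of_real a) (dot_momentum q) \<psi> x)"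

definition hamiltonian ::
    "(int ^ 'd) set \<Rightarrow> (int ^ 'd \<Rightarrow> complex ^ 'c ^ 'c)
      \<Rightarrow> ('d::finite, 'c::finite) wavefun \<Rightarrow> ('d, 'c) wavefun" where
  "hamiltonian Q A \<psi> = (\<lambda>x. \<Sum>q\<in>Q. A q *v dot_momentum q \<psi> x)"

text \<open>The limit \<open>a \<rightarrow> 0\<close> through positive \<open>a\<close> for which \<open>t / a\<close> is an integer.\<close>

definition lattice_spacings :: "real \<Rightarrow> real filter" where
  "lattice_spacings t = at 0 within {a. 0 < a \<and> t / a \<in> \<nat>}"

end

theory Submission
  imports Defs
begin

text \<open>In momentum space both evolutions are multiplication by matrix-valued symbols, and the
  \<open>L\<^sup>2\<close> bounds below are obtained without Plancherel's theorem. Call a symbol bounded by \<open>C\<close> if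
  the corresponding operator has norm at most \<open>C\<close> on band-limited functions; this is stable under
  sums, products and (by Fatou) pointwise limits. Translations are bounded by \<open>1\<close>, and so is the
  symbol of the walk, since lattice unitarity can be integrated over a cell of side \<open>a\<close>. The arcsin
  series gives Bernstein's inequality, so \<open>e\<^bsup>-isq\<cdot>p\<^esup> - 1\<close> is \<open>O(s\<Lambda>)\<close>. As the walk is massless,
  \<open>U\<^sub>a\<close> and \<open>U\<^bsub>a/2\<^esub>\<^sup>2\<close> agree to second order in these differences, so they differ by \<open>O(a\<^sup>2\<Lambda>\<^sup>2)\<close>, and
  telescoping bounds \<open>U\<^bsub>a/2\<^esub>\<^bsup>2N\<^esup> - U\<^sub>a\<^bsup>N\<^esup>\<close> by \<open>O(ta\<Lambda>\<^sup>2)\<close>. Halving \<open>a\<close> repeatedly gives a geometric series, while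
  the symbols converge pointwise to that of \<open>e\<^bsup>-iHt\<^esup>\<close>, so \<open>e\<^bsup>-iHt\<^esup> - U\<^sub>a\<^bsup>N\<^esup>\<close> is \<open>O(ta\<Lambda>\<^sup>2)\<close> as well.\<close>


section \<open>Bounded operators as a Banach algebra\<close>

text \<open>The obstacle is that a pointwise bound on a matrix-valued symbol does not by itself
  yield an operator bound in this setting. Every operator bound has to be assembled from constant
  complex-linear maps, translations and the walk, whose effect on \<open>L2_norm\<close> can be read
  off in position space. For e^(-iHt) such an assembly through the power series yields only exp(C t
  L) at cutoff L, and telescoping powers of U_a against powers of e^(-iHa) would inherit that
  factor. The walks of spacing a and a/2, in contrast, are both contractions, so they are compared
  with each other, and the errors then add up linearly in the number of steps. The exponential of H
  enters only as a pointwise limit of symbols. Pointwise bounds are used as well, but only to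
  dominate integrands in limits; they may grow exponentially with the cutoff because they never
  reach the final estimate.\<close>

typedef (overloaded) 'a endo = "UNIV :: ('a::real_normed_vector \<Rightarrow>\<^sub>L 'a) set"
  morphisms blinfun_of_endo Endo ..

setup_lifting type_definition_endo

instantiation endo :: (real_normed_vector) real_normed_vector
begin

lift_definition zero_endo :: "'a endo" is "0" .
lift_definition plus_endo :: "'a endo \<Rightarrow> 'a endo \<Rightarrow> 'a endo" is "(+)" .
lift_definition minus_endo :: "'a endo \<Rightarrow> 'a endo \<Rightarrow> 'a endo" is "(-)" .
lift_definition uminus_endo :: "'a endo \<Rightarrow> 'a endo" is "uminus" .
lift_definition scaleR_endo :: "real \<Rightarrow> 'a endo \<Rightarrow> 'a endo" is "(*\<^sub>R)" .
lift_definition norm_endo :: "'a endo \<Rightarrow> real" is "norm" .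
definition dist_endo :: "'a endo \<Rightarrow> 'a endo \<Rightarrow> real" where "dist_endo a b = norm (a - b)"
definition sgn_endo :: "'a endo \<Rightarrow> 'a endo" where "sgn_endo x = inverse (norm x) *\<^sub>R x"
definition uniformity_endo_def:
  "(uniformity :: ('a endo \<times> 'a endo) filter) = (INF e\<in>{0 <..}. principal {(x, y). dist x y < e})"
definition open_endo :: "'a endo set \<Rightarrow> bool" where
  "open_endo S = (\<forall>x\<in>S. \<forall>\<^sub>F (x', y) in uniformity. x' = x \<longrightarrow> y \<in> S)"

instance
  apply standard
  unfolding dist_endo_def open_endo_def sgn_endo_def uniformity_endo_def
  apply (rule refl | (transfer; force simp: algebra_simps norm_triangle_ineq))+
  done

end

text \<open>The wrapper type exists so that composition can serve as the multiplication of a normed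
  algebra; powers and \<open>exp\<close> of non-commuting symbols are then the generic ones.
  \<open>perfect_space\<close> excludes the zero space, on which the identity would have norm
  0.\<close>

instantiation endo :: ("{real_normed_vector, perfect_space}") real_normed_algebra_1
begin

lift_definition one_endo :: "'a endo" is "id_blinfun" .
lift_definition times_endo :: "'a endo \<Rightarrow> 'a endo \<Rightarrow> 'a endo" is "(o\<^sub>L)" .

instance
proof
  fix a b c :: "'a endo" and r :: real
  show "a * b * c = a * (b * c)" by transfer (rule blinfun_eqI, simp)
  show "1 * a = a" by transfer (rule blinfun_eqI, simp)
  show "a * 1 = a" by transfer (rule blinfun_eqI, simp)
  show "(a + b) * c = a * c + b * c" by transfer (rule blinfun_eqI, simp add: blinfun.bilinear_simps)
  show "a * (b + c) = a * b + a * c" by transfer (rule blinfun_eqI, simp add: blinfun.bilinear_simps)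
  show "r *\<^sub>R a * b = r *\<^sub>R (a * b)" by transfer (rule blinfun_eqI, simp add: blinfun.bilinear_simps)
  show "a * r *\<^sub>R b = r *\<^sub>R (a * b)" by transfer (rule blinfun_eqI, simp add: blinfun.bilinear_simps)
  show "norm (a * b) \<le> norm a * norm b" by transfer (rule norm_blinfun_compose)
  show "norm (1 :: 'a endo) = 1" by transfer (rule norm_blinfun_id)
  have "norm (1 :: 'a endo) = 1" by transfer (rule norm_blinfun_id)
  then show "(0 :: 'a endo) \<noteq> 1" by (metis norm_zero zero_neq_one)
qed

end

instance endo :: (banach) banach
proof
  fix X :: "nat \<Rightarrow> 'a endo"
  have nb: "norm (blinfun_of_endo a - blinfun_of_endo b) = norm (a - b)" for a b :: "'a endo"
    by transfer simp
  assume "Cauchy X"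
  then have "Cauchy (\<lambda>n. blinfun_of_endo (X n))"
    unfolding Cauchy_def dist_norm nb .
  then obtain l where "(\<lambda>n. blinfun_of_endo (X n)) \<longlonglongrightarrow> l"
    using Cauchy_convergent_iff convergent_def by blast
  then have "X \<longlonglongrightarrow> Endo l"
    unfolding LIMSEQ_def dist_norm by (metis UNIV_I Endo_inverse nb)
  then show "convergent X" by (rule convergentI)
qed

lift_definition app :: "'a::real_normed_vector endo \<Rightarrow> 'a \<Rightarrow> 'a" is blinfun_apply .

lemma bounded_bilinear_app: "bounded_bilinear app"
proof
  show "\<exists>K. \<forall>a b. norm (app a b) \<le> norm (a::'a endo) * norm b * K"
    by (intro exI[of _ 1]) (transfer, simp add: norm_blinfun)
qed (transfer, simp add: blinfun.bilinear_simps)+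

interpretation app: bounded_bilinear app by (rule bounded_bilinear_app)

lemma norm_app_le: "norm (app T v) \<le> norm T * norm v"
  by transfer (rule norm_blinfun)

lemma norm_endo_bound: "0 \<le> b \<Longrightarrow> (\<And>v. norm (app T v) \<le> b * norm v) \<Longrightarrow> norm T \<le> b"
  by transfer (rule norm_blinfun_bound)

lemma endo_eqI: "(\<And>v. app S v = app T v) \<Longrightarrow> S = T"
  by transfer (rule blinfun_eqI)

lemma app_mult [simp]: "app (S * T) v = app S (app T v)"
  by transfer simp

lemma app_one [simp]: "app 1 v = v"
  by transfer simp

definition endo_of :: "('a::real_normed_vector \<Rightarrow> 'a) \<Rightarrow> 'a endo" where
  "endo_of f = Endo (Blinfun f)"

lemma app_endo_of [simp]: "bounded_linear f \<Longrightarrow> app (endo_of f) = f"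
  by (simp add: endo_of_def app.rep_eq Endo_inverse bounded_linear_Blinfun_apply)

section \<open>Exponentials in a Banach algebra\<close>

lemma norm_power_diff_le:
  fixes X Y :: "'a::real_normed_algebra_1"
  assumes "norm X \<le> r" "norm Y \<le> r"
  shows "norm (X ^ Suc n - Y ^ Suc n) \<le> real (Suc n) * r ^ n * norm (X - Y)"
proof (induction n)
  case (Suc n)
  have r: "0 \<le> r" using assms(1) norm_ge_zero order_trans by blast
  have "X ^ Suc (Suc n) - Y ^ Suc (Suc n) = X * (X ^ Suc n - Y ^ Suc n) + (X - Y) * Y ^ Suc n"
    by (simp add: algebra_simps)
  also have "norm \<dots> \<le> norm X * norm (X ^ Suc n - Y ^ Suc n) + norm (X - Y) * norm (Y ^ Suc n)"
    by (intro norm_triangle_le add_mono norm_mult_ineq)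
  also have "\<dots> \<le> r * (real (Suc n) * r ^ n * norm (X - Y)) + norm (X - Y) * r ^ Suc n"
    by (intro add_mono mult_mono Suc.IH assms order.refl norm_ge_zero r order_trans[OF norm_power_ineq] power_mono)
  finally show ?case by (simp add: algebra_simps)
qed simp

lemma norm_power_le_exp:
  fixes X :: "'a::real_normed_algebra_1"
  shows "norm (X ^ n) \<le> exp (real n * norm (X - 1))"
proof -
  have "norm X \<le> 1 + norm (X - 1)"
    using norm_triangle_ineq[of 1 "X - 1"] by simp
  also have "\<dots> \<le> exp (norm (X - 1))" by (rule exp_ge_add_one_self)
  finally have "norm X ^ n \<le> exp (norm (X - 1)) ^ n" by (rule power_mono) simp
  then show ?thesis using norm_power_ineq[of X n] by (simp add: exp_of_nat_mult)
qed

text \<open>Termwise comparison, with 1/(n+2)! weakened to 1/(n+1)!. The closed form is o(norm x),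
  and it serves both for algebra elements and for the complex phases that are differentiated
  later.\<close>

lemma norm_exp_minus_one_minus_le:
  fixes x :: "'a::{real_normed_algebra_1, banach}"
  shows "norm (exp x - 1 - x) \<le> norm x * (exp (norm x) - 1)"
proof -
  have s: "(\<lambda>n. x ^ Suc (Suc n) /\<^sub>R fact (Suc (Suc n))) sums (exp x - 1 - x)"
    using exp_converges[of x] sums_Suc_iff[of "\<lambda>n. x ^ n /\<^sub>R fact n"]
      sums_Suc_iff[of "\<lambda>n. x ^ Suc n /\<^sub>R fact (Suc n)"] by simp
  have r: "(\<lambda>n. norm x * (norm x ^ Suc n /\<^sub>R fact (Suc n))) sums (norm x * (exp (norm x) - 1))"
    using exp_converges[of "norm x"] sums_Suc_iff[of "\<lambda>n. norm x ^ n /\<^sub>R fact n"]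
    by (intro sums_mult) simp
  have "norm (x ^ Suc (Suc n) /\<^sub>R fact (Suc (Suc n))) \<le> norm x * (norm x ^ Suc n /\<^sub>R fact (Suc n))" for n
  proof -
    have "norm (x ^ Suc (Suc n)) / fact (Suc (Suc n)) \<le> norm x ^ Suc (Suc n) / fact (Suc n)"
      by (intro frac_le norm_power_ineq fact_mono) auto
    then show ?thesis by (simp del: fact_Suc add: field_simps)
  qed
  then show ?thesis
    using norm_suminf_le[of "\<lambda>n. x ^ Suc (Suc n) /\<^sub>R fact (Suc (Suc n))" "\<lambda>n. norm x * (norm x ^ Suc n /\<^sub>R fact (Suc n))"]
      s r sums_summable[OF r] by (simp add: sums_iff)
qed

lemma tendsto_exp_scaled:
  fixes x :: "'a::{real_normed_algebra_1, banach}"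
  assumes n: "filterlim n at_top F"
  shows "((\<lambda>k. real (n k) *\<^sub>R (exp (x /\<^sub>R real (n k)) - 1)) \<longlongrightarrow> x) F"
proof -
  have "((\<lambda>k. norm x * (exp (norm x / real (n k)) - 1)) \<longlongrightarrow> norm x * (exp 0 - 1)) F"
    using filterlim_compose[OF filterlim_real_sequentially n]
    by (intro tendsto_intros real_tendsto_divide_at_top) auto
  then have "((\<lambda>k. norm x * (exp (norm x / real (n k)) - 1)) \<longlongrightarrow> 0) F" by simp
  moreover have "\<forall>\<^sub>F k in F. norm (real (n k) *\<^sub>R (exp (x /\<^sub>R real (n k)) - 1) - x)
      \<le> norm x * (exp (norm x / real (n k)) - 1)"
  proof -
    have "\<forall>\<^sub>F k in F. 0 < n k" by (rule eventually_compose_filterlim[OF eventually_gt_at_top n])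
    then show ?thesis
    proof eventually_elim
      case (elim k)
      let ?y = "x /\<^sub>R real (n k)"
      have "real (n k) *\<^sub>R (exp ?y - 1) - x = real (n k) *\<^sub>R (exp ?y - 1 - ?y)"
        using elim by (simp add: scaleR_diff_right)
      also have "norm \<dots> = real (n k) * norm (exp ?y - 1 - ?y)" by simp
      also have "\<dots> \<le> real (n k) * (norm ?y * (exp (norm ?y) - 1))"
        by (intro mult_left_mono norm_exp_minus_one_minus_le) simp
      also have "\<dots> = norm x * (exp (norm x / real (n k)) - 1)" using elim by (simp add: field_simps)
      finally show ?case .
    qed
  qed
  ultimately have "((\<lambda>k. real (n k) *\<^sub>R (exp (x /\<^sub>R real (n k)) - 1) - x) \<longlongrightarrow> 0) F"
    by (rule Lim_null_comparison[rotated])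
  then show ?thesis by (simp add: LIM_zero_iff)
qed

lemma exp_scaleR_nat:
  fixes x :: "'a::{real_normed_algebra_1, banach}"
  shows "exp (real n *\<^sub>R x) = exp x ^ n"
proof (induction n)
  case (Suc n)
  have "exp (x + real n *\<^sub>R x) = exp x * exp (real n *\<^sub>R x)"
    by (rule exp_add_commuting) simp
  with Suc show ?case by (simp add: scaleR_left_distrib)
qed simp

text \<open>The compound-interest limit (1 + x/n + o(1/n))^n -> exp x without commutativity. The
  comparison is with \<open>Y k\<close> = exp(x/n), whose n-th power is exp x exactly. Both bases
  have norm at most exp(B/n), so telescoping n factors costs no more than exp B times the rescaled
  difference \<open>D k\<close>.\<close>

lemma tendsto_power_exp:
  fixes x :: "'a::{real_normed_algebra_1, banach}"
  assumes n: "filterlim n at_top F"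
    and X: "((\<lambda>k. real (n k) *\<^sub>R (X k - 1)) \<longlongrightarrow> x) F"
  shows "((\<lambda>k. X k ^ n k) \<longlongrightarrow> exp x) F"
proof -
  define Y where "Y k = exp (x /\<^sub>R real (n k))" for k
  define D where "D k = norm (real (n k) *\<^sub>R (X k - 1) - real (n k) *\<^sub>R (Y k - 1))" for k
  have Y: "((\<lambda>k. real (n k) *\<^sub>R (Y k - 1)) \<longlongrightarrow> x) F"
    unfolding Y_def by (rule tendsto_exp_scaled[OF n])
  have D: "(D \<longlongrightarrow> 0) F"
    unfolding D_def using tendsto_norm[OF tendsto_diff[OF X Y]] by simp
  define B where "B = norm x + 1"
  have ev: "\<forall>\<^sub>F k in F. 0 < n k" by (rule eventually_compose_filterlim[OF eventually_gt_at_top n])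
  have "\<forall>\<^sub>F k in F. norm (real (n k) *\<^sub>R (X k - 1)) < B"
    using tendsto_norm[OF X] by (intro order_tendstoD) (auto simp: B_def)
  moreover have "\<forall>\<^sub>F k in F. norm (real (n k) *\<^sub>R (Y k - 1)) < B"
    using tendsto_norm[OF Y] by (intro order_tendstoD) (auto simp: B_def)
  ultimately have "\<forall>\<^sub>F k in F. norm (X k ^ n k - exp x) \<le> exp B * D k"
    using ev
  proof eventually_elim
    case (elim k)
    obtain m where m: "n k = Suc m" using elim(3) by (cases "n k") auto
    define r where "r = exp (B / n k)"
    have bd: "norm Z \<le> r" if "norm (real (n k) *\<^sub>R (Z - 1)) < B" for Z :: 'a
    proof -
      have "real (n k) * norm (Z - 1) < B"
        using that by (metis norm_scaleR abs_of_nat)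
      then have Z: "norm (Z - 1) \<le> B / n k" using elim(3) by (simp add: field_simps)
      have "norm Z \<le> 1 + norm (Z - 1)" using norm_triangle_ineq[of 1 "Z - 1"] by simp
      also have "norm (Z - 1) \<le> B / n k" by (rule Z)
      also have "1 + B / n k \<le> exp (B / n k)" by (rule exp_ge_add_one_self)
      finally show ?thesis by (simp add: r_def)
    qed
    have "exp x = Y k ^ n k"
      using elim(3) by (simp add: Y_def exp_scaleR_nat[symmetric])
    then have "norm (X k ^ n k - exp x) = norm (X k ^ Suc m - Y k ^ Suc m)" by (simp add: m)
    also have "\<dots> \<le> real (Suc m) * r ^ m * norm (X k - Y k)"
      by (rule norm_power_diff_le) (rule bd elim(1,2))+
    also have "\<dots> = r ^ m * D k"
      unfolding D_def by (simp add: m scaleR_diff_right[symmetric] del: of_nat_Suc)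
    also have "\<dots> \<le> exp B * D k"
    proof (rule mult_right_mono)
      have "r ^ m \<le> r ^ n k" unfolding m by (rule power_increasing) (auto simp: r_def B_def)
      also have "r ^ n k = exp B" using elim(3) by (simp add: r_def exp_of_nat_mult[symmetric])
      finally show "r ^ m \<le> exp B" .
    qed (simp add: D_def)
    finally show ?case .
  qed
  then have "((\<lambda>k. X k ^ n k - exp x) \<longlongrightarrow> 0) F"
    by (rule Lim_null_comparison) (use tendsto_mult_right_zero[OF D] in simp)
  then show ?thesis by (simp add: LIM_zero_iff)
qed

lemma continuous_on_exp_algebra:
  fixes R :: real
  shows "continuous_on (cball (0::'a::{real_normed_algebra_1, banach}) R) exp"
proof -
  have le: "norm (x ^ n /\<^sub>R fact n) \<le> R ^ n /\<^sub>R fact n" if "x \<in> cball 0 R" for n and x :: 'a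
  proof -
    have "norm (x ^ n) \<le> R ^ n"
      using that by (intro order_trans[OF norm_power_ineq] power_mono) auto
    then show ?thesis by (simp add: field_simps)
  qed
  have "uniform_limit (cball 0 R) (\<lambda>n x. \<Sum>i<n. x ^ i /\<^sub>R fact i) (exp :: 'a \<Rightarrow> 'a) sequentially"
    unfolding exp_def using le summable_exp_generic[of R] by (rule Weierstrass_m_test)
  then show ?thesis
    by (rule uniform_limit_theorem[rotated]) (auto intro!: always_eventually allI continuous_intros)
qed


section \<open>The L2 norm\<close>

text \<open>\<open>L2_norm\<close> contains a case split at infinity. This lemma and the next two
  remove it by passing to squares, so that later arguments concern nonnegative integrals
  only.\<close>

lemma L2_norm_le_iff:
  assumes "0 \<le> c"
  shows "L2_norm f \<le> ennreal c \<longleftrightarrow> (\<integral>\<^sup>+ x. ennreal ((norm (f x))\<^sup>2) \<partial>lborel) \<le> ennreal (c\<^sup>2)"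
proof (cases "\<integral>\<^sup>+ x. ennreal ((norm (f x))\<^sup>2) \<partial>lborel")
  case (real r)
  then show ?thesis
    using assms by (auto simp: L2_norm_def Let_def ennreal_le_iff real_sqrt_le_iff' sqrt_le_D intro: real_le_lsqrt)
next
  case top
  then show ?thesis by (simp add: L2_norm_def Let_def top_unique)
qed

lemma L2_norm_le_ennreal_iff:
  "L2_norm f \<le> c \<longleftrightarrow> (\<integral>\<^sup>+ x. ennreal ((norm (f x))\<^sup>2) \<partial>lborel) \<le> c\<^sup>2"
proof (cases c)
  case (real r)
  then show ?thesis by (simp add: L2_norm_le_iff ennreal_power)
qed (simp add: power_eq_top_ennreal_iff top_power_ennreal)

lemma L2_norm_mono_iff:
  "L2_norm f \<le> L2_norm g \<longleftrightarrow>
    (\<integral>\<^sup>+ x. ennreal ((norm (f x))\<^sup>2) \<partial>lborel) \<le> (\<integral>\<^sup>+ x. ennreal ((norm (g x))\<^sup>2) \<partial>lborel)"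
proof -
  have "(L2_norm g)\<^sup>2 = (\<integral>\<^sup>+ x. ennreal ((norm (g x))\<^sup>2) \<partial>lborel)"
    by (cases "\<integral>\<^sup>+ x. ennreal ((norm (g x))\<^sup>2) \<partial>lborel")
      (auto simp: L2_norm_def Let_def ennreal_power power_eq_top_ennreal_iff top_power_ennreal)
  then show ?thesis by (simp add: L2_norm_le_ennreal_iff)
qed

lemma L2_norm_le_mult:
  assumes "0 \<le> C" "\<And>x. norm (f x) \<le> C * norm (g x)" "g \<in> borel_measurable borel"
  shows "L2_norm f \<le> ennreal C * L2_norm g"
proof -
  have "(\<integral>\<^sup>+ x. ennreal ((norm (f x))\<^sup>2) \<partial>lborel)
      \<le> (\<integral>\<^sup>+ x. ennreal (C\<^sup>2) * ennreal ((norm (g x))\<^sup>2) \<partial>lborel)"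
    using power_mono[OF assms(2) norm_ge_zero, of _ 2]
    by (intro nn_integral_mono) (simp add: ennreal_mult[symmetric] power_mult_distrib)
  also have "\<dots> = ennreal (C\<^sup>2) * (\<integral>\<^sup>+ x. ennreal ((norm (g x))\<^sup>2) \<partial>lborel)"
    using assms(3) by (intro nn_integral_cmult) measurable
  also have "\<dots> \<le> ennreal (C\<^sup>2) * (L2_norm g)\<^sup>2"
    by (intro mult_left_mono) (simp_all add: L2_norm_le_ennreal_iff[symmetric])
  finally show ?thesis
    using assms(1) by (simp add: L2_norm_le_ennreal_iff power_mult_distrib ennreal_power)
qed

text \<open>Optimise \<open>s\<close> in \<open>(u + v)\<^sup>2 \<le> (1 + s) u\<^sup>2 + (1 + 1/s) v\<^sup>2\<close>.\<close>

lemma L2_norm_triangle: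
  assumes f[measurable]: "f \<in> borel_measurable borel" and g[measurable]: "g \<in> borel_measurable borel"
  shows "L2_norm (\<lambda>x. f x + g x) \<le> L2_norm f + L2_norm g"
proof (cases "L2_norm f = \<infinity> \<or> L2_norm g = \<infinity>")
  case False
  then obtain r s where r: "L2_norm f = ennreal r" "0 \<le> r" and s: "L2_norm g = ennreal s" "0 \<le> s"
    by (cases "L2_norm f"; cases "L2_norm g") auto
  have "L2_norm (\<lambda>x. f x + g x) \<le> ennreal (r + s) + ennreal e" if "0 < e" for e
  proof -
    \<comment> \<open>The extra e/2 makes both u and v positive, so that the weights v/u and u/v
      make sense even when one of the norms is 0.\<close>
    define u where "u = r + e / 2"
    define v where "v = s + e / 2"
    have uv: "0 < u" "0 < v" using r s that by (auto simp: u_def v_def)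
    have If: "(\<integral>\<^sup>+ x. ennreal ((norm (f x))\<^sup>2) \<partial>lborel) \<le> ennreal (u\<^sup>2)"
      using uv r that by (subst L2_norm_le_iff[symmetric]) (auto simp: u_def intro!: ennreal_leI)
    have Ig: "(\<integral>\<^sup>+ x. ennreal ((norm (g x))\<^sup>2) \<partial>lborel) \<le> ennreal (v\<^sup>2)"
      using uv s that by (subst L2_norm_le_iff[symmetric]) (auto simp: v_def intro!: ennreal_leI)
    have pw: "(norm (f x + g x))\<^sup>2 \<le> (1 + v / u) * (norm (f x))\<^sup>2 + (1 + u / v) * (norm (g x))\<^sup>2" for x
    proof -
      have "(norm (f x + g x))\<^sup>2 \<le> (norm (f x) + norm (g x))\<^sup>2"
        by (intro power_mono norm_triangle_ineq norm_ge_zero)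
      moreover have "2 * norm (f x) * norm (g x) \<le> v / u * (norm (f x))\<^sup>2 + u / v * (norm (g x))\<^sup>2"
      proof -
        have "0 \<le> (v * norm (f x) - u * norm (g x))\<^sup>2 / (u * v)" using uv by simp
        then show ?thesis using uv by (simp add: power2_eq_square field_simps)
      qed
      ultimately show ?thesis by (simp add: power2_eq_square algebra_simps)
    qed
    have "(\<integral>\<^sup>+ x. ennreal ((norm (f x + g x))\<^sup>2) \<partial>lborel)
        \<le> (\<integral>\<^sup>+ x. ennreal (1 + v / u) * ennreal ((norm (f x))\<^sup>2)
              + ennreal (1 + u / v) * ennreal ((norm (g x))\<^sup>2) \<partial>lborel)"
      using uv by (intro nn_integral_mono)
        (simp add: ennreal_mult[symmetric] ennreal_plus[symmetric] pw del: ennreal_plus)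
    also have "\<dots> = ennreal (1 + v / u) * (\<integral>\<^sup>+ x. ennreal ((norm (f x))\<^sup>2) \<partial>lborel)
        + ennreal (1 + u / v) * (\<integral>\<^sup>+ x. ennreal ((norm (g x))\<^sup>2) \<partial>lborel)"
      by (simp add: nn_integral_add nn_integral_cmult)
    also have "\<dots> \<le> ennreal (1 + v / u) * ennreal (u\<^sup>2) + ennreal (1 + u / v) * ennreal (v\<^sup>2)"
      by (intro add_mono mult_left_mono If Ig) auto
    also have "\<dots> = ennreal ((1 + v / u) * u\<^sup>2 + (1 + u / v) * v\<^sup>2)"
      using uv by (simp add: ennreal_mult[symmetric] ennreal_plus[symmetric] del: ennreal_plus)
    also have "(1 + v / u) * u\<^sup>2 + (1 + u / v) * v\<^sup>2 = (u + v)\<^sup>2"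
      using uv by (simp add: power2_eq_square field_simps)
    finally have "L2_norm (\<lambda>x. f x + g x) \<le> ennreal (u + v)"
      using uv by (subst L2_norm_le_iff) auto
    also have "u + v = (r + s) + e" unfolding u_def v_def by simp
    also have "ennreal ((r + s) + e) = ennreal (r + s) + ennreal e"
      using r s that by (subst ennreal_plus) simp_all
    finally show ?thesis .
  qed
  then have "L2_norm (\<lambda>x. f x + g x) \<le> ennreal (r + s)"
    by (rule ennreal_le_epsilon)
  then show ?thesis using r s by simp
qed auto

lemma L2_norm_translate:
  assumes [measurable]: "f \<in> borel_measurable borel"
  shows "L2_norm (\<lambda>x. f (x + y)) = L2_norm f"
proof -
  have "(\<integral>\<^sup>+ x. ennreal ((norm (f x))\<^sup>2) \<partial>lborel)
      = (\<integral>\<^sup>+ x. ennreal ((norm (f x))\<^sup>2) \<partial>distr lborel borel ((+) y))"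
    by (simp add: lborel_distr_plus)
  also have "\<dots> = (\<integral>\<^sup>+ x. ennreal ((norm (f (y + x)))\<^sup>2) \<partial>lborel)"
    by (subst nn_integral_distr) auto
  finally show ?thesis by (simp add: L2_norm_def add.commute)
qed

lemma L2_norm_limit_le:
  assumes [measurable]: "\<And>k. f k \<in> borel_measurable borel"
    and lim: "\<And>x. (\<lambda>k. f k x) \<longlonglongrightarrow> g x"
    and le: "\<And>k. L2_norm (f k) \<le> c"
  shows "L2_norm g \<le> c"
proof -
  have "(\<integral>\<^sup>+ x. ennreal ((norm (g x))\<^sup>2) \<partial>lborel)
      = (\<integral>\<^sup>+ x. liminf (\<lambda>k. ennreal ((norm (f k x))\<^sup>2)) \<partial>lborel)"
    by (intro nn_integral_cong lim_imp_Liminf[symmetric] tendsto_ennrealI tendsto_intros lim) simp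
  also have "\<dots> \<le> liminf (\<lambda>k. \<integral>\<^sup>+ x. ennreal ((norm (f k x))\<^sup>2) \<partial>lborel)"
    by (rule nn_integral_liminf) measurable
  also have "\<dots> \<le> limsup (\<lambda>k. \<integral>\<^sup>+ x. ennreal ((norm (f k x))\<^sup>2) \<partial>lborel)"
    by (rule Liminf_le_Limsup) simp
  also have "\<dots> \<le> c\<^sup>2"
    using le by (intro Limsup_bounded always_eventually) (simp add: L2_norm_le_ennreal_iff)
  finally show ?thesis by (simp add: L2_norm_le_ennreal_iff)
qed

section \<open>Complex scalars as operators\<close>

lemma norm_vector_smult: "norm (z *s v) = cmod z * norm (v :: complex ^ 'n)"
  by (simp add: norm_vec_def L2_set_right_distrib norm_mult)

lemma bounded_linear_smult: "bounded_linear (\<lambda>v :: complex ^ 'n. z *s v)"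
  by (rule bounded_linear_intro[where K="cmod z"])
    (auto simp: vec_eq_iff algebra_simps norm_vector_smult)

text \<open>Elements of \<open>endo\<close> are real-linear maps, so complex scalars have to enter
  as operators. Phases, the imaginary unit and the coin matrices then live in one real Banach
  algebra.\<close>

definition cscal :: "complex \<Rightarrow> (complex ^ 'n) endo" where
  "cscal z = endo_of (\<lambda>v. z *s v)"

lemma app_cscal [simp]: "app (cscal z) v = z *s v"
  by (simp add: cscal_def bounded_linear_smult)

lemma bounded_linear_cscal: "bounded_linear (cscal :: _ \<Rightarrow> (complex ^ 'n) endo)"
proof (rule bounded_linear_intro[where K=1])
  show "norm (cscal z :: (complex ^ 'n) endo) \<le> norm z * 1" for z
    by (rule norm_endo_bound) (simp_all add: norm_vector_smult)
qed (auto intro!: endo_eqI simp: vec_eq_iff algebra_simps app.bilinear_simps app.add_left app.scaleR_left)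

lemmas linear_cscal = bounded_linear.linear[OF bounded_linear_cscal]
lemmas cscal_add = linear_add[OF linear_cscal]
lemmas cscal_diff = linear_diff[OF linear_cscal]
lemmas cscal_scaleR = linear_scale[OF linear_cscal]
lemmas cscal_sum = linear_sum[OF linear_cscal]

lemma norm_cscal_le: "norm (cscal z) \<le> cmod z"
  by (rule norm_endo_bound) (simp_all add: norm_vector_smult)

lemma cscal_mult: "cscal (w * z) = cscal w * cscal z"
  by (rule endo_eqI) (simp add: vec_eq_iff)

lemma cscal_1 [simp]: "cscal 1 = 1"
  by (rule endo_eqI) simp

lemma cscal_power: "cscal (z ^ n) = cscal z ^ n"
  by (induction n) (simp_all add: cscal_mult)

lemma cscal_of_real: "cscal (of_real r) = r *\<^sub>R 1"
  using cscal_scaleR[of r 1] by (simp add: scaleR_conv_of_real)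

lemma cscal_exp: "cscal (exp z) = exp (cscal z)"
  unfolding exp_def
  by (subst bounded_linear.suminf[OF bounded_linear_cscal summable_exp_generic])
    (simp add: cscal_scaleR cscal_power)

text \<open>This is what allows a constant operator to be pulled out of an integral against the
  complex phase of a plane wave; membership in \<open>endo\<close> alone gives only real
  linearity.\<close>

definition complex_linear :: "(complex ^ 'n) endo \<Rightarrow> bool" where
  "complex_linear T \<longleftrightarrow> (\<forall>z. T * cscal z = cscal z * T)"

lemma complex_linear_app: "complex_linear T \<Longrightarrow> app T (z *s v) = z *s app T v"
  unfolding complex_linear_def by (metis app_cscal app_mult)


section \<open>Band-limited functions\<close>

definition momentum_box :: "real \<Rightarrow> (real ^ 'd) set" where
  "momentum_box L = {p. \<forall>b. \<bar>p $ b\<bar> \<le> L}"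

lemma momentum_box_eq_cbox: "momentum_box L = cbox (\<chi> i. - L) (\<chi> i. L)"
  by (auto simp: momentum_box_def mem_box_cart abs_le_iff) (smt (verit))+

lemma compact_momentum_box: "compact (momentum_box L)"
  by (simp add: momentum_box_eq_cbox)

lemma momentum_box_borel [measurable]: "momentum_box L \<in> sets borel"
  by (simp add: momentum_box_eq_cbox)

text \<open>Integrability replaces the square integrability of \<open>cutoff_states\<close>: it
  makes the plane-wave integral absolutely convergent and survives multiplication by any symbol
  continuous on the box. The superposition itself may have infinite \<open>L2_norm\<close>.\<close>

definition momentum_states :: "real \<Rightarrow> ('d::finite, 'c::finite) wavefun set" where
  "momentum_states L = {g. integrable lborel g \<and> (\<forall>p. p \<notin> momentum_box L \<longrightarrow> g p = 0)}"

lemma measurable_smult [measurable (raw)]: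
  assumes "f \<in> borel_measurable M" "g \<in> borel_measurable M"
  shows "(\<lambda>x. f x *s (g x :: complex ^ 'c)) \<in> borel_measurable M"
  using assms
proof (rule borel_measurable_continuous_Pair)
  show "continuous_on UNIV (\<lambda>x. fst x *s (snd x :: complex ^ 'c))"
    unfolding vector_scalar_mult_def by (intro continuous_intros)
qed

lemma momentum_states_apply:
  assumes g: "g \<in> momentum_states L" and M: "continuous_on (momentum_box L) M"
  shows "(\<lambda>p. app (M p) (g p)) \<in> momentum_states L"
proof -
  have int: "integrable lborel g" and supp: "\<And>p. p \<notin> momentum_box L \<Longrightarrow> g p = 0"
    using g by (auto simp: momentum_states_def)
  have [measurable]: "g \<in> borel_measurable borel" using int by simp
  have [measurable]: "(\<lambda>p. indicator (momentum_box L) p *\<^sub>R app (M p) v) \<in> borel_measurable borel" for v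
    by (intro borel_measurable_continuous_on_indicator momentum_box_borel
        app.continuous_on M continuous_intros)
  \<comment> \<open>M is continuous only on the box. Expanding g p in the real basis reduces
    measurability to the functions M p i for fixed i, cut off by the indicator; outside the box both
    sides vanish with g.\<close>
  have eq: "app (M p) (g p) = (\<Sum>i\<in>Basis. (g p \<bullet> i) *\<^sub>R (indicator (momentum_box L) p *\<^sub>R app (M p) i))" for p
  proof (cases "p \<in> momentum_box L")
    case True
    have "app (M p) (g p) = app (M p) (\<Sum>i\<in>Basis. (g p \<bullet> i) *\<^sub>R i)"
      by (simp add: euclidean_representation)
    with True show ?thesis by (simp add: app.sum_right app.scaleR_right)
  qed (simp add: supp app.zero_right)
  have meas: "(\<lambda>p. app (M p) (g p)) \<in> borel_measurable lborel"
    unfolding eq by measurable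
  have "bounded (M ` momentum_box L)"
    by (intro compact_imp_bounded compact_continuous_image M compact_momentum_box)
  then obtain B where B: "\<And>p. p \<in> momentum_box L \<Longrightarrow> norm (M p) \<le> B"
    by (auto simp: bounded_iff)
  have "integrable lborel (\<lambda>p. app (M p) (g p))"
  proof (rule Bochner_Integration.integrable_bound[OF _ meas])
    show "integrable lborel (\<lambda>p. B * norm (g p))" using int by simp
    show "AE p in lborel. norm (app (M p) (g p)) \<le> norm (B * norm (g p))"
    proof (rule AE_I2)
      fix p
      show "norm (app (M p) (g p)) \<le> norm (B * norm (g p))"
      proof (cases "p \<in> momentum_box L")
        case True
        then have "norm (M p) * norm (g p) \<le> B * norm (g p)"
          by (intro mult_right_mono B) auto
        then show ?thesis using norm_app_le[of "M p" "g p"] by simp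
      qed (simp add: supp app.zero_right)
    qed
  qed
  then show ?thesis by (simp add: momentum_states_def supp app.zero_right)
qed

text \<open>L2 is contained in L1 on a set of finite measure, here through u <= 1 + u^2 with the
  constant 1 integrated over the box.\<close>

lemma L2_box_momentum_states:
  assumes g: "g \<in> L2_states" and supp: "\<And>p. g p \<noteq> 0 \<Longrightarrow> \<forall>b. \<bar>p $ b\<bar> \<le> L"
  shows "g \<in> momentum_states L"
proof -
  have [measurable]: "g \<in> borel_measurable borel" and fin: "L2_norm g < \<infinity>"
    using g by (auto simp: L2_states_def)
  from fin have "(\<integral>\<^sup>+ p. ennreal ((norm (g p))\<^sup>2) \<partial>lborel) < \<infinity>"
    by (cases "(\<integral>\<^sup>+ p. ennreal ((norm (g p))\<^sup>2) \<partial>lborel)") (auto simp: L2_norm_def)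
  then have int2: "integrable lborel (\<lambda>p. (norm (g p))\<^sup>2)"
    by (intro integrableI_nonneg) auto
  have "integrable lborel (indicator (momentum_box L) :: _ \<Rightarrow> real)"
    by (intro integrable_real_indicator emeasure_bounded_finite compact_imp_bounded compact_momentum_box) simp
  then have int: "integrable lborel (\<lambda>p. indicator (momentum_box L) p + (norm (g p))\<^sup>2)"
    using int2 by (rule Bochner_Integration.integrable_add)
  have "integrable lborel g"
  proof (rule Bochner_Integration.integrable_bound[OF int])
    show "AE p in lborel. norm (g p) \<le> norm (indicator (momentum_box L) p + (norm (g p))\<^sup>2)"
    proof (rule AE_I2)
      fix p
      show "norm (g p) \<le> norm (indicator (momentum_box L) p + (norm (g p))\<^sup>2)"
      proof (cases "g p = 0")
        case False
        then have "p \<in> momentum_box L" using supp by (simp add: momentum_box_def)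
        moreover have "norm (g p) \<le> 1 + (norm (g p))\<^sup>2"
          using zero_le_power2[of "norm (g p) - 1"] norm_ge_zero[of "g p"]
          unfolding power2_diff one_power2 mult_1_right by linarith
        ultimately show ?thesis by simp
      qed simp
    qed
  qed simp
  then show ?thesis using supp by (auto simp: momentum_states_def momentum_box_def)
qed

lemma continuous_on_cscal [continuous_intros]:
  "continuous_on S f \<Longrightarrow> continuous_on S (\<lambda>x. cscal (f x))"
  by (rule bounded_linear.continuous_on[OF bounded_linear_cscal])

section \<open>Plane-wave superpositions: measurability, limits, linearity, translations\<close>

definition phase :: "real ^ 'd \<Rightarrow> real ^ 'd \<Rightarrow> complex" where
  "phase x p = of_real ((2 * pi) powr (- real CARD('d) / 2)) * cis (p \<bullet> x)"

lemma plane_wave_superposition_eq: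
  "plane_wave_superposition g x = (LINT p|lborel. phase x p *s g p)"
  by (simp add: plane_wave_superposition_def phase_def)

lemma continuous_on_cis [continuous_intros]:
  "continuous_on S f \<Longrightarrow> continuous_on S (\<lambda>x. cis (f x))"
  unfolding cis_conv_exp by (intro continuous_intros)

lemma continuous_on_phase: "continuous_on S (phase x)"
  unfolding phase_def by (intro continuous_intros)

lemma integrable_phase:
  assumes "g \<in> momentum_states L"
  shows "integrable lborel (\<lambda>p. phase x p *s g p)"
proof -
  have "(\<lambda>p. app (cscal (phase x p)) (g p)) \<in> momentum_states L"
    by (intro momentum_states_apply assms continuous_intros continuous_on_phase)
  then show ?thesis by (simp add: momentum_states_def)
qed

lemma measurable_plane_wave_superposition:
  assumes "g \<in> momentum_states L"
  shows "plane_wave_superposition g \<in> borel_measurable borel"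
proof -
  have [measurable]: "g \<in> borel_measurable borel" using assms by (auto simp: momentum_states_def)
  have [measurable]: "cis \<in> borel_measurable borel"
    by (intro borel_measurable_continuous_onI continuous_intros)
  show ?thesis
    unfolding plane_wave_superposition_def by measurable
qed

lemma plane_wave_superposition_tendsto:
  assumes g: "g \<in> momentum_states L"
    and M: "\<And>k. continuous_on (momentum_box L) (M k)" "continuous_on (momentum_box L) N"
    and B: "\<And>k p. p \<in> momentum_box L \<Longrightarrow> norm (M k p) \<le> B"
    and lim: "\<And>p. p \<in> momentum_box L \<Longrightarrow> (\<lambda>k. M k p) \<longlonglongrightarrow> N p"
  shows "(\<lambda>k. plane_wave_superposition (\<lambda>p. app (M k p) (g p)) x)
          \<longlonglongrightarrow> plane_wave_superposition (\<lambda>p. app (N p) (g p)) x"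
  unfolding plane_wave_superposition_eq
proof (rule integral_dominated_convergence)
  have int: "integrable lborel g" and supp: "\<And>p. p \<notin> momentum_box L \<Longrightarrow> g p = 0"
    using g by (auto simp: momentum_states_def)
  show "(\<lambda>p. phase x p *s app (N p) (g p)) \<in> borel_measurable lborel"
    using integrable_phase[OF momentum_states_apply[OF g M(2)]] by (rule borel_measurable_integrable)
  show "(\<lambda>p. phase x p *s app (M k p) (g p)) \<in> borel_measurable lborel" for k
    using integrable_phase[OF momentum_states_apply[OF g M(1)]] by (rule borel_measurable_integrable)
  let ?c = "cmod (of_real ((2 * pi) powr (- real CARD('a) / 2)))"
  show "integrable lborel (\<lambda>p. ?c * (B * norm (g p)))" using int by simp
  show "AE p in lborel. (\<lambda>k. phase x p *s app (M k p) (g p)) \<longlonglongrightarrow> phase x p *s app (N p) (g p)"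
  proof (rule AE_I2)
    fix p
    show "(\<lambda>k. phase x p *s app (M k p) (g p)) \<longlonglongrightarrow> phase x p *s app (N p) (g p)"
    proof (cases "p \<in> momentum_box L")
      case True
      have "(\<lambda>k. app (cscal (phase x p)) (app (M k p) (g p)))
          \<longlonglongrightarrow> app (cscal (phase x p)) (app (N p) (g p))"
        by (intro app.tendsto tendsto_const lim True)
      then show ?thesis by simp
    qed (simp add: supp app.zero_right)
  qed
  show "AE p in lborel. norm (phase x p *s app (M k p) (g p)) \<le> ?c * (B * norm (g p))" for k
  proof (rule AE_I2)
    fix p
    show "norm (phase x p *s app (M k p) (g p)) \<le> ?c * (B * norm (g p))"
    proof (cases "p \<in> momentum_box L")
      case True
      have "norm (app (M k p) (g p)) \<le> B * norm (g p)"
        by (rule order_trans[OF norm_app_le]) (intro mult_right_mono B True norm_ge_zero)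
      then show ?thesis by (simp add: norm_vector_smult phase_def norm_mult mult_left_mono)
    qed (simp add: supp app.zero_right)
  qed
qed

lemma plane_wave_superposition_add:
  assumes "g \<in> momentum_states L" "h \<in> momentum_states L"
  shows "plane_wave_superposition (\<lambda>p. g p + h p) x
    = plane_wave_superposition g x + plane_wave_superposition h x"
  unfolding plane_wave_superposition_eq
  by (simp add: vector_add_ldistrib integrable_phase[OF assms(1)] integrable_phase[OF assms(2)])

lemma plane_wave_superposition_apply:
  assumes "g \<in> momentum_states L" "complex_linear T"
  shows "plane_wave_superposition (\<lambda>p. app T (g p)) x = app T (plane_wave_superposition g x)"
proof -
  have "app T (LINT p|lborel. phase x p *s g p) = (LINT p|lborel. app T (phase x p *s g p))"
    by (intro integral_bounded_linear[symmetric] app.bounded_linear_right integrable_phase[OF assms(1)])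
  then show ?thesis
    unfolding plane_wave_superposition_eq complex_linear_app[OF assms(2)] by simp
qed

lemma plane_wave_superposition_translate:
  "plane_wave_superposition (\<lambda>p. app (cscal (cis (p \<bullet> y))) (g p)) x = plane_wave_superposition g (x + y)"
  unfolding plane_wave_superposition_eq
  by (intro Bochner_Integration.integral_cong)
    (auto simp: phase_def inner_add_right cis_mult[symmetric] vec_eq_iff)

section \<open>Fourier multipliers on band-limited functions\<close>

text \<open>Working with symbols turns composition of operators into pointwise multiplication in
  \<open>endo\<close>. Continuity on the box is included because it keeps
  \<open>momentum_states\<close> invariant, so that multipliers can be composed.\<close>

definition multiplier_le :: "real \<Rightarrow> (real ^ 'd \<Rightarrow> (complex ^ 'c) endo) \<Rightarrow> real \<Rightarrow> bool" where
  "multiplier_le L M C \<longleftrightarrow> continuous_on (momentum_box L) M \<and> 0 \<le> C \<and>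
     (\<forall>g\<in>momentum_states L. L2_norm (plane_wave_superposition (\<lambda>p. app (M p) (g p)))
        \<le> ennreal C * L2_norm (plane_wave_superposition g))"

lemma multiplier_leD:
  assumes "multiplier_le L M C"
  shows "continuous_on (momentum_box L) M" "0 \<le> C"
    "\<And>g. g \<in> momentum_states L \<Longrightarrow> L2_norm (plane_wave_superposition (\<lambda>p. app (M p) (g p)))
        \<le> ennreal C * L2_norm (plane_wave_superposition g)"
  using assms by (auto simp: multiplier_le_def)

lemma multiplier_le_mono: "multiplier_le L M C \<Longrightarrow> C \<le> D \<Longrightarrow> multiplier_le L M D"
  unfolding multiplier_le_def
  by (meson ennreal_leI mult_right_mono order_trans zero_le)

lemma multiplier_le_add:
  assumes "multiplier_le L M C" "multiplier_le L N D"
  shows "multiplier_le L (\<lambda>p. M p + N p) (C + D)"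
  unfolding multiplier_le_def
proof (intro conjI ballI)
  show "continuous_on (momentum_box L) (\<lambda>p. M p + N p)"
    by (intro continuous_intros multiplier_leD[OF assms(1)] multiplier_leD[OF assms(2)])
  show "0 \<le> C + D" using multiplier_leD(2)[OF assms(1)] multiplier_leD(2)[OF assms(2)] by simp
  fix g :: "('a, 'b) wavefun" assume g: "g \<in> momentum_states L"
  note Mg = momentum_states_apply[OF g multiplier_leD(1)[OF assms(1)]]
  note Ng = momentum_states_apply[OF g multiplier_leD(1)[OF assms(2)]]
  have "plane_wave_superposition (\<lambda>p. app (M p + N p) (g p))
     = (\<lambda>x. plane_wave_superposition (\<lambda>p. app (M p) (g p)) x + plane_wave_superposition (\<lambda>p. app (N p) (g p)) x)"
    by (rule ext) (simp add: app.add_left plane_wave_superposition_add[OF Mg Ng])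
  then have "L2_norm (plane_wave_superposition (\<lambda>p. app (M p + N p) (g p)))
      \<le> L2_norm (plane_wave_superposition (\<lambda>p. app (M p) (g p))) + L2_norm (plane_wave_superposition (\<lambda>p. app (N p) (g p)))"
    using L2_norm_triangle[OF measurable_plane_wave_superposition[OF Mg] measurable_plane_wave_superposition[OF Ng]]
    by simp
  also have "\<dots> \<le> ennreal C * L2_norm (plane_wave_superposition g) + ennreal D * L2_norm (plane_wave_superposition g)"
    by (intro add_mono multiplier_leD(3)[OF assms(1)] multiplier_leD(3)[OF assms(2)] g)
  also have "\<dots> = ennreal (C + D) * L2_norm (plane_wave_superposition g)"
    using multiplier_leD(2)[OF assms(1)] multiplier_leD(2)[OF assms(2)]
    by (simp add: distrib_right)
  finally show "L2_norm (plane_wave_superposition (\<lambda>p. app (M p + N p) (g p)))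
      \<le> ennreal (C + D) * L2_norm (plane_wave_superposition g)" .
qed

lemma multiplier_le_mult:
  assumes "multiplier_le L M C" "multiplier_le L N D"
  shows "multiplier_le L (\<lambda>p. M p * N p) (C * D)"
  unfolding multiplier_le_def
proof (intro conjI ballI)
  show "continuous_on (momentum_box L) (\<lambda>p. M p * N p)"
    by (intro continuous_intros multiplier_leD[OF assms(1)] multiplier_leD[OF assms(2)])
  show "0 \<le> C * D" using multiplier_leD(2)[OF assms(1)] multiplier_leD(2)[OF assms(2)] by simp
  fix g :: "('a, 'b) wavefun" assume g: "g \<in> momentum_states L"
  note Ng = momentum_states_apply[OF g multiplier_leD(1)[OF assms(2)]]
  have "L2_norm (plane_wave_superposition (\<lambda>p. app (M p * N p) (g p)))
      \<le> ennreal C * L2_norm (plane_wave_superposition (\<lambda>p. app (N p) (g p)))"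
    using multiplier_leD(3)[OF assms(1) Ng] by simp
  also have "\<dots> \<le> ennreal C * (ennreal D * L2_norm (plane_wave_superposition g))"
    by (intro mult_left_mono multiplier_leD(3)[OF assms(2)] g) simp
  also have "\<dots> = ennreal (C * D) * L2_norm (plane_wave_superposition g)"
    using multiplier_leD(2)[OF assms(1)] multiplier_leD(2)[OF assms(2)]
    by (simp add: ennreal_mult mult.assoc)
  finally show "L2_norm (plane_wave_superposition (\<lambda>p. app (M p * N p) (g p)))
      \<le> ennreal (C * D) * L2_norm (plane_wave_superposition g)" .
qed

lemma multiplier_le_const:
  assumes "complex_linear T"
  shows "multiplier_le L (\<lambda>_. T) (norm T)"
  unfolding multiplier_le_def
proof (intro conjI ballI)
  fix g :: "('b, 'a) wavefun" assume g: "g \<in> momentum_states L"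
  show "L2_norm (plane_wave_superposition (\<lambda>p. app T (g p))) \<le> ennreal (norm T) * L2_norm (plane_wave_superposition g)"
    by (rule L2_norm_le_mult)
      (simp_all add: plane_wave_superposition_apply[OF g assms] norm_app_le measurable_plane_wave_superposition[OF g])
qed simp_all

lemma complex_linear_cscal [simp]: "complex_linear (cscal z)"
  by (simp add: complex_linear_def cscal_mult[symmetric] mult.commute)

lemma multiplier_le_cscal: "multiplier_le L (\<lambda>_. cscal z) (cmod z)"
  by (rule multiplier_le_mono[OF multiplier_le_const norm_cscal_le]) simp

lemma multiplier_le_0: "multiplier_le L (\<lambda>_. 0) 0"
  by (rule multiplier_le_cscal[where z = 0, unfolded linear_0[OF linear_cscal] norm_zero])

lemma multiplier_le_1: "multiplier_le L (\<lambda>_. 1) 1"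
  by (rule multiplier_le_cscal[where z = 1, unfolded cscal_1 norm_one])

lemma multiplier_le_cscal_mult:
  assumes "multiplier_le L M C"
  shows "multiplier_le L (\<lambda>p. cscal z * M p) (cmod z * C)"
  by (rule multiplier_le_mult[OF multiplier_le_cscal assms])

lemma multiplier_le_diff:
  assumes "multiplier_le L M C" "multiplier_le L N D"
  shows "multiplier_le L (\<lambda>p. M p - N p) (C + D)"
  using multiplier_le_add[OF assms(1) multiplier_le_cscal_mult[OF assms(2), of "- 1"]]
  by (simp add: linear_neg[OF linear_cscal])

lemma multiplier_le_sum:
  assumes "finite I" "\<And>i. i \<in> I \<Longrightarrow> multiplier_le L (M i) (C i)"
  shows "multiplier_le L (\<lambda>p. \<Sum>i\<in>I. M i p) (\<Sum>i\<in>I. C i)"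
  using assms by (induction I rule: finite_induct) (auto intro: multiplier_le_0 multiplier_le_add)

lemma multiplier_le_power:
  assumes "multiplier_le L M C"
  shows "multiplier_le L (\<lambda>p. M p ^ n) (C ^ n)"
  by (induction n) (auto intro: multiplier_le_1 multiplier_le_mult assms)

text \<open>Telescoping between two contractions: since all powers are bounded by 1, the error grows
  only linearly in n.\<close>

lemma multiplier_le_power_diff:
  assumes "multiplier_le L M 1" "multiplier_le L N 1" "multiplier_le L (\<lambda>p. M p - N p) e"
  shows "multiplier_le L (\<lambda>p. M p ^ n - N p ^ n) (real n * e)"
proof (induction n)
  case 0
  then show ?case by (simp add: multiplier_le_0)
next
  case (Suc n)
  have "multiplier_le L (\<lambda>p. M p * (M p ^ n - N p ^ n) + (M p - N p) * N p ^ n) (1 * (real n * e) + e * 1 ^ n)"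
    by (intro multiplier_le_add multiplier_le_mult multiplier_le_power assms Suc)
  then show ?case by (simp add: algebra_simps)
qed

text \<open>Two unrelated bounds occur. C is the operator bound, carried to the limit by Fatou; B is
  a pointwise bound that dominates the plane-wave integrals and is absent from the conclusion.
  Pointwise convergence of the symbols, with no rate, is enough.\<close>

lemma multiplier_le_limit:
  assumes M: "\<And>k. multiplier_le L (M k) C" and N: "continuous_on (momentum_box L) N"
    and B: "\<And>k p. p \<in> momentum_box L \<Longrightarrow> norm (M k p) \<le> B"
    and lim: "\<And>p. p \<in> momentum_box L \<Longrightarrow> (\<lambda>k. M k p) \<longlonglongrightarrow> N p"
  shows "multiplier_le L N C"
  unfolding multiplier_le_def
proof (intro conjI ballI N multiplier_leD(2)[OF M])
  fix g :: "('a, 'b) wavefun" assume g: "g \<in> momentum_states L"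
  show "L2_norm (plane_wave_superposition (\<lambda>p. app (N p) (g p))) \<le> ennreal C * L2_norm (plane_wave_superposition g)"
  proof (rule L2_norm_limit_le)
    show "plane_wave_superposition (\<lambda>p. app (M k p) (g p)) \<in> borel_measurable borel" for k
      by (rule measurable_plane_wave_superposition[OF momentum_states_apply[OF g multiplier_leD(1)[OF M]]])
    show "(\<lambda>k. plane_wave_superposition (\<lambda>p. app (M k p) (g p)) x)
        \<longlonglongrightarrow> plane_wave_superposition (\<lambda>p. app (N p) (g p)) x" for x
      by (rule plane_wave_superposition_tendsto[OF g multiplier_leD(1)[OF M] N B lim])
    show "L2_norm (plane_wave_superposition (\<lambda>p. app (M k p) (g p))) \<le> ennreal C * L2_norm (plane_wave_superposition g)" for k
      by (rule multiplier_leD(3)[OF M g])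
  qed
qed

lemma multiplier_le_translation: "multiplier_le L (\<lambda>p. cscal (cis (p \<bullet> y))) 1"
  unfolding multiplier_le_def
proof (intro conjI ballI)
  show "continuous_on (momentum_box L) (\<lambda>p. cscal (cis (p \<bullet> y)))"
    by (intro continuous_intros)
  fix g :: "('a, 'b) wavefun" assume g: "g \<in> momentum_states L"
  show "L2_norm (plane_wave_superposition (\<lambda>p. app (cscal (cis (p \<bullet> y))) (g p)))
      \<le> ennreal 1 * L2_norm (plane_wave_superposition g)"
    unfolding plane_wave_superposition_translate
    by (simp add: L2_norm_translate[OF measurable_plane_wave_superposition[OF g]])
qed simp


section \<open>A Bernstein inequality\<close>

text \<open>The derivative of arcsin is the binomial series of (1 - x^2)^(-1/2), whose coefficients
  are nonnegative; arcsin is identified by equality of derivatives and of values at 0.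
  \<open>f n\<close> is the coefficient of x^(n+1), hence zero for odd n.\<close>

lemma arcsin_power_series:
  obtains f :: "nat \<Rightarrow> real"
  where "\<And>n. 0 \<le> f n" "\<And>N. (\<Sum>n<N. f n) \<le> pi / 2"
    "\<And>x. \<bar>x\<bar> < 1 \<Longrightarrow> (\<lambda>n. f n * x ^ Suc n) sums arcsin x"
proof -
  \<comment> \<open>These are the numbers binom(2k, k) / 4^k, written in the form that the
    generalised binomial series produces.\<close>
  define c :: "nat \<Rightarrow> real" where "c k = pochhammer (1/2) k / fact k" for k
  define f :: "nat \<Rightarrow> real" where "f n = (if even n then c (n div 2) / real (Suc n) else 0)" for n
  have f0: "0 \<le> f n" for n
    by (simp add: f_def c_def pochhammer_nonneg)
  have deriv: "(\<lambda>n. f n * real (Suc n) * x ^ n) sums inverse (sqrt (1 - x\<^sup>2))" if "\<bar>x\<bar> < 1" for x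
  proof -
    have x2: "x\<^sup>2 < 1" using that by (simp add: abs_square_less_1)
    have "(\<lambda>k. ((- 1/2) gchoose k) * (- x\<^sup>2) ^ k) sums (1 + - x\<^sup>2) powr (- 1/2)"
      using x2 by (intro gen_binomial_real) simp
    also have "(\<lambda>k. ((- 1/2) gchoose k) * (- x\<^sup>2) ^ k) = (\<lambda>k. c k * x ^ (2 * k))"
    proof
      fix k
      have "(- x\<^sup>2) ^ k = (- 1) ^ k * x ^ (2 * k)"
        by (subst power_minus) (simp add: power_mult)
      then show "((- 1/2) gchoose k) * (- x\<^sup>2) ^ k = c k * x ^ (2 * k)"
        by (simp add: gbinomial_pochhammer c_def power_mult_distrib[symmetric] mult.assoc[symmetric])
    qed
    also have "(1 + - x\<^sup>2) powr (- 1/2) = inverse (sqrt (1 - x\<^sup>2))"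
      using x2 by (simp add: powr_minus powr_half_sqrt)
    finally have "(\<lambda>k. f (2 * k) * real (Suc (2 * k)) * x ^ (2 * k)) sums inverse (sqrt (1 - x\<^sup>2))"
      by (simp add: f_def del: of_nat_Suc)
    then show ?thesis
      by (subst (asm) sums_mono_reindex[of "\<lambda>k. 2 * k"])
        (auto simp: strict_mono_def f_def elim!: evenE)
  qed
  have summ: "summable (\<lambda>n. f n * x ^ Suc n)" if "\<bar>x\<bar> < 1" for x
  proof (rule summable_comparison_test')
    show "summable (\<lambda>n. f n * real (Suc n) * \<bar>x\<bar> ^ n)"
      using deriv[of "\<bar>x\<bar>"] that by (auto simp: sums_iff)
    fix n
    have "\<bar>x\<bar> ^ Suc n \<le> \<bar>x\<bar> ^ n" using that by (simp add: mult_left_le_one_le)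
    also have "\<dots> \<le> real (Suc n) * \<bar>x\<bar> ^ n" by (simp add: distrib_right)
    finally show "norm (f n * x ^ Suc n) \<le> f n * real (Suc n) * \<bar>x\<bar> ^ n"
      using f0[of n] by (simp del: of_nat_Suc power_Suc add: abs_mult power_abs mult.assoc mult_left_mono)
  qed
  define F where "F x = (\<Sum>n. f n * x ^ Suc n)" for x
  have DF: "DERIV F x :> inverse (sqrt (1 - x\<^sup>2))" if "\<bar>x\<bar> < 1" for x
  proof -
    have "DERIV (\<lambda>x. \<Sum>n. f n * x ^ Suc n) x :> (\<Sum>n. f n * real (Suc n) * x ^ n)"
      by (rule DERIV_power_series'[where R=1]) (use that deriv in \<open>auto simp: sums_iff\<close>)
    also have "(\<Sum>n. f n * real (Suc n) * x ^ n) = inverse (sqrt (1 - x\<^sup>2))"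
      using deriv[OF that] by (simp add: sums_iff)
    finally show ?thesis unfolding F_def .
  qed
  have eq: "F x = arcsin x" if "\<bar>x\<bar> < 1" for x
  proof -
    have "F x - arcsin x = F 0 - arcsin 0"
    proof (rule DERIV_isconst3[where f="\<lambda>x. F x - arcsin x" and a="- 1" and b=1])
      fix y :: real assume "y \<in> {- 1<..<1}"
      then show "((\<lambda>x. F x - arcsin x) has_real_derivative 0) (at y)"
        using DERIV_diff[OF DF DERIV_arcsin, of y] by auto
    qed (use that in auto)
    then show ?thesis by (simp add: F_def)
  qed
  have sums: "(\<lambda>n. f n * x ^ Suc n) sums arcsin x" if "\<bar>x\<bar> < 1" for x
    using summable_sums[OF summ[OF that]] eq[OF that] by (simp add: F_def)
  \<comment> \<open>For 0 < x < 1 a partial sum lies below the full sum arcsin x <= pi/2, by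
    nonnegativity. A partial sum is a polynomial in x, so x may tend to 1 from the left.\<close>
  have bound: "(\<Sum>n<N. f n) \<le> pi / 2" for N
  proof -
    have "((\<lambda>x. \<Sum>n<N. f n * x ^ Suc n) \<longlongrightarrow> (\<Sum>n<N. f n * 1 ^ Suc n)) (at_left 1)"
      by (intro tendsto_intros)
    moreover have "\<forall>\<^sub>F x in at_left (1::real). (\<Sum>n<N. f n * x ^ Suc n) \<le> pi / 2"
      using eventually_at_left_real[OF zero_less_one]
    proof (eventually_elim)
      case (elim x)
      then have x: "\<bar>x\<bar> < 1" "0 \<le> x" "x < 1" by auto
      have "(\<Sum>n<N. f n * x ^ Suc n) \<le> (\<Sum>n. f n * x ^ Suc n)"
        by (intro sum_le_suminf summ x) (auto simp: f0 x)
      also have "\<dots> = arcsin x" using sums[OF x(1)] by (simp add: sums_iff)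
      also have "\<dots> \<le> pi / 2" using x by (intro arcsin_ubound) auto
      finally show ?case .
    qed
    ultimately have "(\<Sum>n<N. f n * 1 ^ Suc n) \<le> pi / 2"
      by (rule tendsto_upperbound) simp
    then show ?thesis by simp
  qed
  show ?thesis using that f0 bound sums by blast
qed

text \<open>\<open>\<theta> = arcsin (sin \<theta>)\<close> near the origin, and the power series of arcsin has nonnegative
  coefficients with sum at most \<open>\<pi>/2\<close>, so the multiplier \<open>\<theta>\<close> is controlled by \<open>sin \<theta>\<close>,
  a combination of two translations.\<close>

lemma multiplier_le_coordinate:
  fixes b :: "'d::finite"
  assumes L: "0 < L"
  shows "multiplier_le L (\<lambda>p :: real ^ 'd. cscal (of_real (p $ b)) :: (complex ^ 'n) endo) (L * (pi / 2))"
proof -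
  obtain f :: "nat \<Rightarrow> real" where f: "\<And>n. 0 \<le> f n" "\<And>N. (\<Sum>n<N. f n) \<le> pi / 2"
    and sums: "\<And>x. \<bar>x\<bar> < 1 \<Longrightarrow> (\<lambda>n. f n * x ^ Suc n) sums arcsin x"
    using arcsin_power_series by blast
  define s where "s p = sin (p $ b / L)" for p :: "real ^ 'd"
  \<comment> \<open>The scaling by 1/L brings the angle into [-1, 1], strictly inside (-pi/2, pi/2).
    There arcsin inverts sin, and |sin| < 1 keeps the series convergent.\<close>
  define y :: "real ^ 'd" where "y = axis b (1 / L)"
  have py: "p \<bullet> y = p $ b / L" for p by (simp add: y_def inner_axis)
  have "multiplier_le L (\<lambda>p. cscal (1 / (2 * \<i>)) * (cscal (cis (p \<bullet> y)) - cscal (cis (p \<bullet> (- y)))) :: (complex ^ 'n) endo)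
      (cmod (1 / (2 * \<i>)) * (1 + 1))"
    by (intro multiplier_le_cscal_mult multiplier_le_diff multiplier_le_translation)
  moreover have "cscal (1 / (2 * \<i>)) * (cscal (cis (p \<bullet> y)) - cscal (cis (p \<bullet> (- y)))) = (cscal (of_real (s p)) :: (complex ^ 'n) endo)" for p
  proof -
    have "1 / (2 * \<i>) * (cis (p \<bullet> y) - cis (p \<bullet> (- y))) = of_real (s p)"
      by (simp add: s_def py complex_eq_iff)
    then show ?thesis by (simp only: cscal_mult[symmetric] cscal_diff[symmetric])
  qed
  ultimately have "multiplier_le L (\<lambda>p. cscal (of_real (s p)) :: (complex ^ 'n) endo) (cmod (1 / (2 * \<i>)) * (1 + 1))"
    by (simp only:)
  then have S: "multiplier_le L (\<lambda>p. cscal (of_real (s p)) :: (complex ^ 'n) endo) 1"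
    by (simp add: norm_divide norm_mult)
  define M :: "nat \<Rightarrow> real ^ 'd \<Rightarrow> (complex ^ 'n) endo"
    where "M N p = (\<Sum>n<N. cscal (of_real (f n)) * cscal (of_real (s p)) ^ Suc n)" for N p
  have M_eq: "M N p = cscal (of_real (\<Sum>n<N. f n * s p ^ Suc n))" for N p
    by (simp only: M_def of_real_sum of_real_mult of_real_power cscal_sum cscal_mult cscal_power)
  have box: "\<bar>p $ b / L\<bar> \<le> 1" if "p \<in> momentum_box L" for p
    using that L by (simp add: momentum_box_def)
  have box': "\<bar>s p\<bar> < 1" "arcsin (s p) = p $ b / L" if "p \<in> momentum_box L" for p
  proof -
    have th: "- (pi / 2) < p $ b / L" "p $ b / L < pi / 2"
      using box[OF that] pi_gt3 by linarith+
    then have "0 < (cos (p $ b / L))\<^sup>2" by (intro zero_less_power cos_gt_zero_pi)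
    then have "(s p)\<^sup>2 < 1" using sin_cos_squared_add[of "p $ b / L"] unfolding s_def by linarith
    then show "\<bar>s p\<bar> < 1" by (simp add: abs_square_less_1)
    show "arcsin (s p) = p $ b / L" unfolding s_def using th by (intro arcsin_sin) auto
  qed
  have "multiplier_le L (\<lambda>p. cscal (of_real (p $ b / L)) :: (complex ^ 'n) endo) (pi / 2)"
  proof (rule multiplier_le_limit[where M=M and B="pi / 2"])
    fix N
    have "multiplier_le L (M N) (\<Sum>n<N. cmod (of_real (f n)) * 1 ^ Suc n)"
      unfolding M_def by (intro multiplier_le_sum multiplier_le_cscal_mult multiplier_le_power S) simp
    then show "multiplier_le L (M N) (pi / 2)"
      by (rule multiplier_le_mono) (use f in simp)
    show "norm (M N p) \<le> pi / 2" if "p \<in> momentum_box L" for p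
    proof -
      have "norm (M N p) \<le> \<bar>\<Sum>n<N. f n * s p ^ Suc n\<bar>"
        using norm_cscal_le[of "of_real (\<Sum>n<N. f n * s p ^ Suc n)"] unfolding M_eq norm_of_real .
      also have "\<dots> \<le> (\<Sum>n<N. \<bar>f n * s p ^ Suc n\<bar>)" by (rule sum_abs)
      also have "\<dots> \<le> (\<Sum>n<N. f n)"
      proof (rule sum_mono)
        fix n
        have "\<bar>s p\<bar> ^ Suc n \<le> 1" using box'(1)[OF that] by (intro power_le_one) auto
        then have "f n * \<bar>s p\<bar> ^ Suc n \<le> f n" using f(1)[of n] by (intro mult_left_le)
        then show "\<bar>f n * s p ^ Suc n\<bar> \<le> f n"
          using f(1)[of n] by (simp add: abs_mult power_abs del: power_Suc)
      qed
      also have "\<dots> \<le> pi / 2" by (rule f)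
      finally show ?thesis .
    qed
    show "(\<lambda>N. M N p) \<longlonglongrightarrow> cscal (of_real (p $ b / L))" if "p \<in> momentum_box L" for p
      using sums[OF box'(1)[OF that]] unfolding M_eq sums_def box'(2)[OF that]
      by (intro bounded_linear.tendsto[OF bounded_linear_cscal] tendsto_of_real)
  qed (use L in \<open>auto intro!: continuous_intros\<close>)
  from multiplier_le_cscal_mult[OF this, of "of_real L"] show ?thesis
    using L by (simp add: cscal_mult[symmetric])
qed

section \<open>Operator bounds for inner products, exponentials and differences of
  translations\<close>

lemma multiplier_le_inner:
  fixes y :: "real ^ 'd::finite"
  assumes "0 < L"
  shows "multiplier_le L (\<lambda>p. cscal (of_real (p \<bullet> y)) :: (complex ^ 'n) endo) (L * (pi / 2) * (\<Sum>b\<in>UNIV. \<bar>y $ b\<bar>))"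
proof -
  have "multiplier_le L (\<lambda>p. \<Sum>b\<in>UNIV. cscal (of_real (y $ b)) * cscal (of_real (p $ b)) :: (complex ^ 'n) endo)
      (\<Sum>b\<in>UNIV. cmod (of_real (y $ b)) * (L * (pi / 2)))"
    by (intro multiplier_le_sum multiplier_le_cscal_mult multiplier_le_coordinate assms) simp
  then show ?thesis
    by (simp add: cscal_mult[symmetric] cscal_sum[symmetric] inner_vec_def sum_distrib_left sum_divide_distrib mult_ac)
qed

lemma continuous_on_exp_momentum_box:
  fixes X :: "real ^ 'd \<Rightarrow> (complex ^ 'c) endo"
  assumes "continuous_on (momentum_box L) X"
  shows "continuous_on (momentum_box L) (\<lambda>p. exp (X p))"
proof -
  have "bounded (X ` momentum_box L)"
    by (intro compact_imp_bounded compact_continuous_image assms compact_momentum_box)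
  then obtain R where "\<And>p. p \<in> momentum_box L \<Longrightarrow> norm (X p) \<le> R"
    by (auto simp: bounded_iff)
  then show ?thesis
    by (intro continuous_on_compose2[OF continuous_on_exp_algebra[of R] assms]) auto
qed

text \<open>The Taylor coefficients of exp - 1 are nonnegative, so the same series evaluated at the
  operator bound C bounds the operator. Without the constant term the bound vanishes with C. The
  pointwise bound R in the proof only controls the convergence of the partial sums.\<close>

lemma multiplier_le_exp_minus_1:
  assumes X: "multiplier_le L X C"
  shows "multiplier_le L (\<lambda>p. exp (X p) - 1) (exp C - 1)"
proof -
  have cont: "continuous_on (momentum_box L) X" and C: "0 \<le> C"
    using multiplier_leD[OF X] by auto
  have "bounded (X ` momentum_box L)"
    by (intro compact_imp_bounded compact_continuous_image cont compact_momentum_box)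
  then obtain R where R: "\<And>p. p \<in> momentum_box L \<Longrightarrow> norm (X p) \<le> R"
    by (auto simp: bounded_iff)
  define M where "M N p = (\<Sum>n<N. cscal (of_real (inverse (fact (Suc n)))) * X p ^ Suc n)" for N p
  have M_eq: "M N p = (\<Sum>n<N. X p ^ Suc n /\<^sub>R fact (Suc n))" for N p
    unfolding M_def cscal_of_real by (simp del: fact_Suc)
  have sums: "(\<lambda>n. x ^ Suc n /\<^sub>R fact (Suc n)) sums (exp x - 1)"
    for x :: "'z::{real_normed_algebra_1, banach}"
    using exp_converges[of x] sums_Suc_iff[of "\<lambda>n. x ^ n /\<^sub>R fact n"] by simp
  have partial: "(\<Sum>n<N. r ^ Suc n /\<^sub>R fact (Suc n)) \<le> exp r - 1" if "0 \<le> r" for r :: real and N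
    using sums[of r] that by (intro order_trans[OF sum_le_suminf]) (auto simp: sums_iff simp del: fact_Suc)
  show ?thesis
  proof (rule multiplier_le_limit[where M=M and B="exp R - 1"])
    fix N
    have "multiplier_le L (M N) (\<Sum>n<N. cmod (of_real (inverse (fact (Suc n)))) * C ^ Suc n)"
      unfolding M_def by (intro multiplier_le_sum multiplier_le_cscal_mult multiplier_le_power X) simp
    then show "multiplier_le L (M N) (exp C - 1)"
      unfolding norm_of_real
      by (rule multiplier_le_mono) (use partial[OF C, of N] in \<open>simp del: fact_Suc power_Suc\<close>)
    fix p :: "real ^ 'a" assume p: "p \<in> momentum_box L"
    show "norm (M N p) \<le> exp R - 1"
    proof -
      have "norm (M N p) \<le> (\<Sum>n<N. R ^ Suc n /\<^sub>R fact (Suc n))"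
        unfolding M_eq
      proof (rule sum_norm_le)
        fix n
        have "norm (X p ^ Suc n) \<le> R ^ Suc n"
          by (intro order_trans[OF norm_power_ineq] power_mono R p norm_ge_zero)
        then show "norm (X p ^ Suc n /\<^sub>R fact (Suc n)) \<le> R ^ Suc n /\<^sub>R fact (Suc n)"
          by (simp del: fact_Suc power_Suc add: mult_left_mono)
      qed
      also have "\<dots> \<le> exp R - 1"
        using order_trans[OF norm_ge_zero R[OF p]] by (rule partial)
      finally show ?thesis .
    qed
    show "(\<lambda>N. M N p) \<longlonglongrightarrow> exp (X p) - 1"
      using sums[of "X p"] by (simp only: M_eq sums_def)
  next
    show "continuous_on (momentum_box L) (\<lambda>p. exp (X p) - 1)"
      by (intro continuous_intros continuous_on_exp_momentum_box cont)
  qed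
qed

text \<open>A translation is the exponential of the multiplier i p . y, which the coordinatewise
  Bernstein bound controls by C = L (pi/2) times the l1 length of y. For C <= 1 one has exp C - 1 <=
  C + C^2 <= 2C, which turns pi/2 into pi.\<close>

lemma multiplier_le_translation_diff:
  fixes y :: "real ^ 'd::finite"
  assumes L: "0 < L" and small: "L * (pi / 2) * (\<Sum>b\<in>UNIV. \<bar>y $ b\<bar>) \<le> 1"
  shows "multiplier_le L (\<lambda>p. cscal (cis (p \<bullet> y)) - 1 :: (complex ^ 'n) endo) (L * pi * (\<Sum>b\<in>UNIV. \<bar>y $ b\<bar>))"
proof -
  let ?C = "L * (pi / 2) * (\<Sum>b\<in>UNIV. \<bar>y $ b\<bar>)"
  have "multiplier_le L (\<lambda>p. cscal \<i> * cscal (of_real (p \<bullet> y)) :: (complex ^ 'n) endo) (cmod \<i> * ?C)"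
    by (intro multiplier_le_cscal_mult multiplier_le_inner L)
  then have "multiplier_le L (\<lambda>p. exp (cscal (\<i> * of_real (p \<bullet> y))) - 1 :: (complex ^ 'n) endo) (exp ?C - 1)"
    by (intro multiplier_le_exp_minus_1) (simp add: cscal_mult)
  then have "multiplier_le L (\<lambda>p. cscal (cis (p \<bullet> y)) - 1 :: (complex ^ 'n) endo) (exp ?C - 1)"
    by (simp add: cscal_exp[symmetric] cis_conv_exp)
  moreover have "exp ?C - 1 \<le> L * pi * (\<Sum>b\<in>UNIV. \<bar>y $ b\<bar>)"
  proof -
    have C0: "0 \<le> ?C" using L by (intro mult_nonneg_nonneg sum_nonneg) auto
    have "exp ?C \<le> 1 + ?C + ?C\<^sup>2" by (rule exp_bound[OF C0 small])
    moreover have "?C\<^sup>2 \<le> ?C" unfolding power2_eq_square by (rule mult_left_le[OF small C0])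
    ultimately show ?thesis by simp
  qed
  ultimately show ?thesis by (rule multiplier_le_mono)
qed


section \<open>Unitarity on the lattice carries over to the continuum\<close>

definition lattice_point :: "int ^ 'd \<Rightarrow> real ^ 'd" where
  "lattice_point q = (\<chi> b. of_int (q $ b))"

lemma lattice_point_diff: "lattice_point (m - n) = lattice_point m - lattice_point n"
  by (simp add: lattice_point_def vec_eq_iff)

text \<open>The half-open cells with corners in a Z^d tile space: the cell of x is indexed by the
  coordinatewise floor of x/a. Tonelli, with counting measure on the lattice, exchanges the sum over
  cells with the integral, and translation invariance moves every cell to the origin.\<close>

lemma nn_integral_lattice_cells:
  fixes F :: "real ^ 'd::finite \<Rightarrow> ennreal"
  assumes a: "0 < a" and F[measurable]: "F \<in> borel_measurable borel"
  shows "(\<integral>\<^sup>+ x. F x \<partial>lborel) = (\<integral>\<^sup>+ y. indicator {y. \<forall>b. 0 \<le> y $ b \<and> y $ b < a} y *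
    (\<integral>\<^sup>+ n. F (y + a *\<^sub>R lattice_point n) \<partial>count_space UNIV) \<partial>lborel)"
proof -
  let ?cell = "{y :: real ^ 'd. \<forall>b. 0 \<le> y $ b \<and> y $ b < a}"
  have [measurable]: "?cell \<in> sets borel" by measurable
  interpret pair_sigma_finite "count_space (UNIV :: (int ^ 'd) set)" "lborel :: (real ^ 'd) measure"
    by (intro pair_sigma_finite.intro sigma_finite_measure_count_space_countable sigma_finite_lborel) simp
  have swap: "(\<integral>\<^sup>+ y. (\<integral>\<^sup>+ n. f n y \<partial>count_space UNIV) \<partial>lborel) = (\<integral>\<^sup>+ n. (\<integral>\<^sup>+ y. f n y \<partial>lborel) \<partial>count_space UNIV)"
    if [measurable]: "\<And>n. f n \<in> borel_measurable borel" for f :: "int ^ 'd \<Rightarrow> real ^ 'd \<Rightarrow> ennreal"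
    by (rule Fubini') (rule measurable_pair_measure_countable1; simp)
  have one: "(\<integral>\<^sup>+ n. indicator ?cell (x - a *\<^sub>R lattice_point n) \<partial>count_space UNIV) = 1" for x :: "real ^ 'd"
  proof -
    define m :: "int ^ 'd" where "m = (\<chi> b. \<lfloor>x $ b / a\<rfloor>)"
    have "indicator ?cell (x - a *\<^sub>R lattice_point n) = (indicator {m} n :: ennreal)" for n
    proof -
      have "0 \<le> x $ b - a * of_int (n $ b) \<and> x $ b - a * of_int (n $ b) < a \<longleftrightarrow> \<lfloor>x $ b / a\<rfloor> = n $ b" for b
        using a by (simp add: floor_eq_iff field_simps)
      then have "x - a *\<^sub>R lattice_point n \<in> ?cell \<longleftrightarrow> n = m"
        by (auto simp: lattice_point_def m_def vec_eq_iff)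
      then show ?thesis by (auto simp: indicator_def)
    qed
    then show ?thesis by simp
  qed
  have "(\<integral>\<^sup>+ x. F x \<partial>lborel)
      = (\<integral>\<^sup>+ x. (\<integral>\<^sup>+ n. F x * indicator ?cell (x - a *\<^sub>R lattice_point n) \<partial>count_space UNIV) \<partial>lborel)"
    by (simp add: nn_integral_cmult one)
  also have "\<dots> = (\<integral>\<^sup>+ n. (\<integral>\<^sup>+ x. F x * indicator ?cell (x - a *\<^sub>R lattice_point n) \<partial>lborel) \<partial>count_space UNIV)"
    by (rule swap) measurable
  also have "\<dots> = (\<integral>\<^sup>+ n. (\<integral>\<^sup>+ y. F (y + a *\<^sub>R lattice_point n) * indicator ?cell y \<partial>lborel) \<partial>count_space UNIV)"
  proof (rule nn_integral_cong)
    fix n :: "int ^ 'd"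
    let ?z = "a *\<^sub>R lattice_point n :: real ^ 'd"
    have "(\<integral>\<^sup>+ x. F x * indicator ?cell (x - ?z) \<partial>lborel)
        = (\<integral>\<^sup>+ x. F x * indicator ?cell (x - ?z) \<partial>distr lborel borel ((+) ?z))"
      by (simp add: lborel_distr_plus)
    also have "\<dots> = (\<integral>\<^sup>+ y. F (y + ?z) * indicator ?cell y \<partial>lborel)"
      by (subst nn_integral_distr) (auto simp: add.commute)
    finally show "(\<integral>\<^sup>+ x. F x * indicator ?cell (x - ?z) \<partial>lborel)
      = (\<integral>\<^sup>+ y. F (y + ?z) * indicator ?cell y \<partial>lborel)" .
  qed
  also have "\<dots> = (\<integral>\<^sup>+ y. (\<integral>\<^sup>+ n. F (y + a *\<^sub>R lattice_point n) * indicator ?cell y \<partial>count_space UNIV) \<partial>lborel)"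
    by (rule swap[symmetric]) measurable
  also have "\<dots> = (\<integral>\<^sup>+ y. indicator ?cell y * (\<integral>\<^sup>+ n. F (y + a *\<^sub>R lattice_point n) \<partial>count_space UNIV) \<partial>lborel)"
    by (simp add: nn_integral_multc mult.commute)
  finally show ?thesis .
qed

text \<open>The lattice notions use unordered sums, the decomposition into cells uses integrals over
  counting measure. This lemma and the next translate between them.\<close>

lemma lattice_states_iff:
  "\<phi> \<in> lattice_states \<longleftrightarrow> (\<integral>\<^sup>+ n. ennreal ((norm (\<phi> n))\<^sup>2) \<partial>count_space UNIV) < \<infinity>"
proof -
  have "\<phi> \<in> lattice_states \<longleftrightarrow> integrable (count_space UNIV) (\<lambda>n. (norm (\<phi> n))\<^sup>2)"
    unfolding lattice_states_def abs_summable_on_def[symmetric] abs_summable_equivalent[symmetric] by simp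
  also have "\<dots> \<longleftrightarrow> (\<integral>\<^sup>+ n. ennreal ((norm (\<phi> n))\<^sup>2) \<partial>count_space UNIV) < \<infinity>"
    by (simp add: integrable_iff_bounded)
  finally show ?thesis .
qed

lemma nn_integral_eq_lattice_inner:
  assumes "\<phi> \<in> lattice_states"
  shows "(\<integral>\<^sup>+ n. ennreal ((norm (\<phi> n))\<^sup>2) \<partial>count_space UNIV) = ennreal (Re (lattice_inner \<phi> \<phi>))"
proof -
  have "coin_inner v v = of_real ((norm v)\<^sup>2)" for v :: "complex ^ 'b"
    by (simp add: coin_inner_def norm_vec_def L2_set_def sum_nonneg mult.commute[of "cnj _"] complex_norm_square[symmetric])
  then have "lattice_inner \<phi> \<phi> = of_real (\<Sum>\<^sub>\<infinity>n. (norm (\<phi> n))\<^sup>2)"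
    unfolding lattice_inner_def
    using assms by (simp only: lattice_states_def mem_Collect_eq infsumI[OF has_sum_of_real[OF has_sum_infsum]])
  moreover have s: "Infinite_Set_Sum.abs_summable_on (\<lambda>n. (norm (\<phi> n))\<^sup>2) UNIV"
    using assms unfolding lattice_states_def abs_summable_equivalent[symmetric] by simp
  moreover have "(\<Sum>\<^sub>\<infinity>n. (norm (\<phi> n))\<^sup>2) = infsetsum (\<lambda>n. (norm (\<phi> n))\<^sup>2) UNIV"
    using s by (simp add: infsetsum_infsum)
  ultimately show ?thesis by (simp add: nn_integral_conv_infsetsum)
qed

text \<open>Claimed for arbitrary \<phi>, because the samples of a wave function on one translate of
  the lattice need not be square summable; in that case the right-hand side is infinite.\<close>

lemma lattice_unitary_nn_integral_le:
  assumes "lattice_unitary W"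
  shows "(\<integral>\<^sup>+ n. ennreal ((norm (W \<phi> n))\<^sup>2) \<partial>count_space UNIV)
    \<le> (\<integral>\<^sup>+ n. ennreal ((norm (\<phi> n))\<^sup>2) \<partial>count_space UNIV)"
proof (cases "\<phi> \<in> lattice_states")
  case True
  then have "W \<phi> \<in> lattice_states" "lattice_inner (W \<phi>) (W \<phi>) = lattice_inner \<phi> \<phi>"
    using assms by (auto simp: lattice_unitary_def)
  with True show ?thesis by (simp add: nn_integral_eq_lattice_inner)
next
  case False
  then show ?thesis by (simp add: lattice_states_iff not_less top_unique)
qed

text \<open>Shifts by a q preserve every coset y + a Z^d, so for each offset y the continuum
  operator acts on the samples n -> \<psi>(y + a n) as the lattice walk. The inequality on each
  coset is then integrated over y in one cell.\<close>

lemma L2_norm_walk_le: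
  fixes \<psi> :: "('d::finite, 'c::finite) wavefun"
  assumes unitary: "lattice_unitary (lattice_walk Q A)" and a: "0 < a"
    and [measurable]: "\<psi> \<in> borel_measurable borel"
  shows "L2_norm (\<lambda>x. \<Sum>q\<in>Q. A q *v \<psi> (x - a *\<^sub>R lattice_point q)) \<le> L2_norm \<psi>"
proof -
  have [measurable]: "(\<lambda>x. A q *v \<psi> (x - y)) \<in> borel_measurable borel" for q y
  proof -
    have [measurable]: "(*v) (A q) \<in> borel_measurable borel"
      by (intro borel_measurable_continuous_onI linear_continuous_on matrix_vector_mul_bounded_linear)
    show ?thesis by measurable
  qed
  let ?I = "\<lambda>y. indicator {y :: real ^ 'd. \<forall>b. 0 \<le> y $ b \<and> y $ b < a} y :: ennreal"
  have "(\<integral>\<^sup>+ x. ennreal ((norm (\<Sum>q\<in>Q. A q *v \<psi> (x - a *\<^sub>R lattice_point q)))\<^sup>2) \<partial>lborel)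
      = (\<integral>\<^sup>+ y. ?I y * (\<integral>\<^sup>+ n. ennreal ((norm (\<Sum>q\<in>Q. A q *v
          \<psi> (y + a *\<^sub>R lattice_point n - a *\<^sub>R lattice_point q)))\<^sup>2) \<partial>count_space UNIV) \<partial>lborel)"
    by (rule nn_integral_lattice_cells[OF a]) measurable
  also have "\<dots> = (\<integral>\<^sup>+ y. ?I y * (\<integral>\<^sup>+ n. ennreal ((norm (lattice_walk Q A
          (\<lambda>n. \<psi> (y + a *\<^sub>R lattice_point n)) n))\<^sup>2) \<partial>count_space UNIV) \<partial>lborel)"
    by (simp add: lattice_walk_def lattice_shift_def lattice_point_diff scaleR_diff_right add_diff_eq)
  also have "\<dots> \<le> (\<integral>\<^sup>+ y. ?I y * (\<integral>\<^sup>+ n. ennreal ((norm (\<psi> (y + a *\<^sub>R lattice_point n)))\<^sup>2) \<partial>count_space UNIV) \<partial>lborel)"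
    by (intro nn_integral_mono mult_left_mono lattice_unitary_nn_integral_le unitary) simp
  also have "\<dots> = (\<integral>\<^sup>+ x. ennreal ((norm (\<psi> x))\<^sup>2) \<partial>lborel)"
    by (rule nn_integral_lattice_cells[OF a, symmetric]) measurable
  finally show ?thesis by (simp only: L2_norm_mono_iff)
qed

section \<open>The walk as a Fourier multiplier\<close>

definition endo_of_matrix :: "complex ^ 'c ^ 'c \<Rightarrow> (complex ^ 'c) endo" where
  "endo_of_matrix B = endo_of ((*v) B)"

lemma app_endo_of_matrix [simp]: "app (endo_of_matrix B) v = B *v v"
  by (simp add: endo_of_matrix_def)

lemma complex_linear_endo_of_matrix [simp]: "complex_linear (endo_of_matrix B)"
  unfolding complex_linear_def
  by (auto intro!: endo_eqI simp: matrix_vector_mult_def vec_eq_iff sum_distrib_left mult_ac)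

definition walk_symbol ::
    "(int ^ 'd) set \<Rightarrow> (int ^ 'd \<Rightarrow> complex ^ 'c ^ 'c) \<Rightarrow> real \<Rightarrow> real ^ 'd \<Rightarrow> (complex ^ 'c) endo" where
  "walk_symbol Q A a p = (\<Sum>q\<in>Q. endo_of_matrix (A q) * cscal (cis (p \<bullet> (- a *\<^sub>R lattice_point q))))"

lemma continuous_on_walk_symbol [continuous_intros]: "continuous_on S (walk_symbol Q A a)"
  unfolding walk_symbol_def by (intro continuous_intros)

lemma plane_wave_superposition_sum:
  assumes "finite I" "\<And>i. i \<in> I \<Longrightarrow> g i \<in> momentum_states L"
  shows "plane_wave_superposition (\<lambda>p. \<Sum>i\<in>I. g i p) x = (\<Sum>i\<in>I. plane_wave_superposition (g i) x)"
proof -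
  have "phase x p *s (\<Sum>i\<in>I. g i p) = (\<Sum>i\<in>I. phase x p *s g i p)" for p
    by (simp add: vec_eq_iff sum_distrib_left)
  then show ?thesis
    unfolding plane_wave_superposition_eq by (simp add: integrable_phase[OF assms(2)])
qed

lemma plane_wave_superposition_walk_symbol:
  assumes g: "g \<in> momentum_states L" and fin: "finite Q"
  shows "plane_wave_superposition (\<lambda>p. app (walk_symbol Q A a p) (g p)) x
    = (\<Sum>q\<in>Q. A q *v plane_wave_superposition g (x - a *\<^sub>R lattice_point q))"
proof -
  define h where "h q p = app (cscal (cis (p \<bullet> (- a *\<^sub>R lattice_point q)))) (g p)" for q p
  have h: "h q \<in> momentum_states L" for q
    unfolding h_def by (intro momentum_states_apply g continuous_intros)
  have "plane_wave_superposition (\<lambda>p. app (walk_symbol Q A a p) (g p)) x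
      = plane_wave_superposition (\<lambda>p. \<Sum>q\<in>Q. app (endo_of_matrix (A q)) (h q p)) x"
    by (simp only: walk_symbol_def app.sum_left app_mult h_def)
  also have "\<dots> = (\<Sum>q\<in>Q. plane_wave_superposition (\<lambda>p. app (endo_of_matrix (A q)) (h q p)) x)"
    by (intro plane_wave_superposition_sum[where L=L] fin momentum_states_apply h continuous_intros)
  also have "\<dots> = (\<Sum>q\<in>Q. app (endo_of_matrix (A q)) (plane_wave_superposition (h q) x))"
    by (intro sum.cong refl plane_wave_superposition_apply[OF h]) simp
  also have "\<dots> = (\<Sum>q\<in>Q. A q *v plane_wave_superposition g (x - a *\<^sub>R lattice_point q))"
    unfolding h_def plane_wave_superposition_translate by simp
  finally show ?thesis .
qed

lemma multiplier_le_walk_symbol: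
  assumes "massless_walk Q A" "0 < a"
  shows "multiplier_le L (walk_symbol Q A a) 1"
  unfolding multiplier_le_def
proof (intro conjI ballI continuous_on_walk_symbol)
  fix g :: "('a, 'b) wavefun" assume g: "g \<in> momentum_states L"
  have Q: "finite Q" "lattice_unitary (lattice_walk Q A)" using assms by (auto simp: massless_walk_def)
  have "plane_wave_superposition (\<lambda>p. app (walk_symbol Q A a p) (g p))
      = (\<lambda>x. \<Sum>q\<in>Q. A q *v plane_wave_superposition g (x - a *\<^sub>R lattice_point q))"
    by (rule ext) (rule plane_wave_superposition_walk_symbol[OF g Q(1)])
  then show "L2_norm (plane_wave_superposition (\<lambda>p. app (walk_symbol Q A a p) (g p)))
      \<le> ennreal 1 * L2_norm (plane_wave_superposition g)"
    using L2_norm_walk_le[OF Q(2) assms(2) measurable_plane_wave_superposition[OF g]] by simp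
qed simp


section \<open>The walk and the Hamiltonian in momentum space\<close>

lemma norm_cis_minus_one_le: "cmod (cis x - 1) \<le> \<bar>x\<bar>"
  using abs_sin_x_le_abs_x[of "x / 2"] dist_exp_i_1[of x] by (simp add: cis_conv_exp)

text \<open>Differentiation under the integral sign. The difference quotients of the phase are
  symbols (e^(i p_b s) - 1)/s, bounded by L on the box since |e^(ix) - 1| <= |x|, so dominated
  convergence applies along every sequence s -> 0.\<close>

lemma momentum_plane_wave_superposition:
  assumes g: "g \<in> momentum_states L"
  shows "momentum b (plane_wave_superposition g) x
    = plane_wave_superposition (\<lambda>p. app (cscal (of_real (p $ b))) (g p)) x"
proof -
  define f where "f s = plane_wave_superposition g (x + s *\<^sub>R axis b 1)" for s :: real
  define D where "D = plane_wave_superposition (\<lambda>p. app (cscal (\<i> * of_real (p $ b))) (g p)) x"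
  have f_eq: "f s = plane_wave_superposition (\<lambda>p. app (cscal (cis (p $ b * s))) (g p)) x" for s
    unfolding f_def plane_wave_superposition_translate[symmetric] by (simp add: inner_axis mult.commute)
  have quot: "(f s - f 0) /\<^sub>R s = plane_wave_superposition (\<lambda>p. app (cscal ((cis (p $ b * s) - 1) / of_real s)) (g p)) x"
    (is "?l s = ?r s") if "s \<noteq> 0" for s
  proof -
    have G: "(\<lambda>p. app (cscal ((cis (p $ b * s) - 1) / of_real s)) (g p)) \<in> momentum_states L" (is "?G \<in> _")
      by (intro momentum_states_apply g continuous_intros) (use that in auto)
    have sG: "(\<lambda>p. app (cscal (of_real s)) (?G p)) \<in> momentum_states L"
      by (intro momentum_states_apply G continuous_intros)
    have split: "app (cscal (cis r)) v = app (cscal (of_real s)) (app (cscal ((cis r - 1) / of_real s)) v) + v"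
      for r and v :: "complex ^ 'b"
    proof -
      have "cis r = of_real s * ((cis r - 1) / of_real s) + 1" using that by simp
      then have "cscal (cis r) = (cscal (of_real s) * cscal ((cis r - 1) / of_real s) + 1 :: (complex ^ 'b) endo)"
        by (metis cscal_1 cscal_add cscal_mult)
      then show ?thesis by (simp only: app.add_left app_mult app_one)
    qed
    have "f s = plane_wave_superposition (\<lambda>p. app (cscal (of_real s)) (?G p) + g p) x"
      unfolding f_eq split ..
    also have "\<dots> = app (cscal (of_real s)) (?r s) + plane_wave_superposition g x"
      by (subst plane_wave_superposition_add[OF sG g]) (subst plane_wave_superposition_apply[OF G], simp_all)
    also have "plane_wave_superposition g x = f 0" by (simp add: f_def)
    finally have "f s - f 0 = s *\<^sub>R ?r s" by (simp add: vec_eq_iff scaleR_conv_of_real[where 'a = complex])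
    then show ?thesis using that by simp
  qed
  have "(?l \<longlongrightarrow> D) (at 0)"
    unfolding tendsto_at_iff_sequentially o_def
  proof (intro allI impI)
    fix X :: "nat \<Rightarrow> real" assume X: "\<forall>i. X i \<in> UNIV - {0}" and X0: "X \<longlonglongrightarrow> 0"
    have "(\<lambda>i. ?r (X i)) \<longlonglongrightarrow> D"
      unfolding D_def
    proof (rule plane_wave_superposition_tendsto[OF g, where B=L])
      show "continuous_on (momentum_box L) (\<lambda>p. cscal ((cis (p $ b * X k) - 1) / of_real (X k)))" for k
        using X by (intro continuous_intros) auto
      show "continuous_on (momentum_box L) (\<lambda>p. cscal (\<i> * of_real (p $ b)))"
        by (intro continuous_intros)
      fix p :: "real ^ 'a" assume p: "p \<in> momentum_box L"
      show "norm (cscal ((cis (p $ b * X k) - 1) / of_real (X k)) :: (complex ^ 'b) endo) \<le> L" for k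
      proof -
        have "cmod ((cis (p $ b * X k) - 1) / of_real (X k)) \<le> \<bar>p $ b * X k\<bar> / \<bar>X k\<bar>"
          using norm_cis_minus_one_le[of "p $ b * X k"] by (simp add: norm_divide divide_right_mono)
        also have "\<dots> = \<bar>p $ b\<bar>" using X by (simp add: abs_mult)
        also have "\<dots> \<le> L" using p by (simp add: momentum_box_def)
        finally show ?thesis using norm_cscal_le order_trans by blast
      qed
      have "(\<lambda>k. (cis (p $ b * X k) - 1) / of_real (X k) - \<i> * of_real (p $ b)) \<longlonglongrightarrow> 0"
      proof (rule Lim_null_comparison)
        show "\<forall>\<^sub>F k in sequentially. norm ((cis (p $ b * X k) - 1) / of_real (X k) - \<i> * of_real (p $ b))
            \<le> \<bar>p $ b\<bar> * (exp \<bar>p $ b * X k\<bar> - 1)"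
        proof (intro always_eventually allI)
          fix k
          define r where "r = p $ b * X k"
          have X: "X k \<noteq> 0" using X by auto
          have "(cis r - 1) / of_real (X k) - \<i> * of_real (p $ b)
              = (exp (\<i> * of_real r) - 1 - \<i> * of_real r) / of_real (X k)"
            using X by (simp add: cis_conv_exp r_def diff_divide_distrib)
          also have "norm \<dots> \<le> norm (\<i> * of_real r) * (exp (norm (\<i> * of_real r)) - 1) / \<bar>X k\<bar>"
            unfolding norm_divide norm_of_real by (intro divide_right_mono norm_exp_minus_one_minus_le) simp
          also have "\<dots> = \<bar>p $ b\<bar> * (exp \<bar>r\<bar> - 1)"
            using X by (simp add: norm_mult r_def abs_mult)
          finally show "norm ((cis (p $ b * X k) - 1) / of_real (X k) - \<i> * of_real (p $ b))
            \<le> \<bar>p $ b\<bar> * (exp \<bar>p $ b * X k\<bar> - 1)" by (simp only: r_def)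
        qed
        have "(\<lambda>k. \<bar>p $ b\<bar> * (exp \<bar>p $ b * X k\<bar> - 1)) \<longlonglongrightarrow> \<bar>p $ b\<bar> * (exp \<bar>p $ b * 0\<bar> - 1)"
          by (intro tendsto_intros X0)
        then show "(\<lambda>k. \<bar>p $ b\<bar> * (exp \<bar>p $ b * X k\<bar> - 1)) \<longlonglongrightarrow> 0" by simp
      qed
      then have "(\<lambda>k. (cis (p $ b * X k) - 1) / of_real (X k)) \<longlonglongrightarrow> \<i> * of_real (p $ b)"
        by (simp add: LIM_zero_iff)
      then show "(\<lambda>k. cscal ((cis (p $ b * X k) - 1) / of_real (X k))) \<longlonglongrightarrow> cscal (\<i> * of_real (p $ b))"
        by (rule bounded_linear.tendsto[OF bounded_linear_cscal])
    qed
    moreover have "?l (X i) = ?r (X i)" for i using quot X by simp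
    ultimately show "(\<lambda>i. ?l (X i)) \<longlonglongrightarrow> D" by simp
  qed
  then have "((\<lambda>s. norm (?l s - D)) \<longlongrightarrow> 0) (at 0)"
    using tendsto_norm_zero LIM_zero by blast
  moreover have "\<forall>\<^sub>F s in at 0. norm (?l s - D) = norm (f (0 + s) - f 0 - s *\<^sub>R D) / norm s"
    unfolding eventually_at_filter
  proof (intro always_eventually allI impI)
    fix s :: real assume that: "s \<noteq> 0"
    have "f (0 + s) - f 0 - s *\<^sub>R D = s *\<^sub>R (?l s - D)" using that by (simp add: scaleR_diff_right)
    then show "norm (?l s - D) = norm (f (0 + s) - f 0 - s *\<^sub>R D) / norm s" using that by simp
  qed
  ultimately have "((\<lambda>s. norm (f (0 + s) - f 0 - s *\<^sub>R D) / norm s) \<longlongrightarrow> 0) (at 0)"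
    by (rule Lim_transform_eventually)
  then have "(f has_vector_derivative D) (at 0)"
    unfolding has_vector_derivative_def has_derivative_at by (simp add: bounded_linear_scaleR_left)
  then have "vector_derivative f (at 0) = D" by (rule vector_derivative_at)
  then have "momentum b (plane_wave_superposition g) x = (- \<i>) *s D"
    unfolding momentum_def f_def by simp
  also have "\<dots> = app (cscal (- \<i>)) D" by simp
  also have "\<dots> = plane_wave_superposition (\<lambda>p. app (cscal (- \<i>)) (app (cscal (\<i> * of_real (p $ b))) (g p))) x"
    unfolding D_def
    by (intro plane_wave_superposition_apply[OF momentum_states_apply[OF g], symmetric]
        complex_linear_cscal continuous_intros)
  also have "\<dots> = plane_wave_superposition (\<lambda>p. app (cscal (of_real (p $ b))) (g p)) x"
    by (simp add: vec_eq_iff mult.assoc[symmetric])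
  finally show ?thesis .
qed

lemma dot_momentum_plane_wave_superposition:
  assumes g: "g \<in> momentum_states L"
  shows "dot_momentum q (plane_wave_superposition g)
    = plane_wave_superposition (\<lambda>p. app (cscal (of_real (p \<bullet> lattice_point q))) (g p))"
proof
  fix x
  have pg: "(\<lambda>p. app (cscal (of_real (p $ b))) (g p)) \<in> momentum_states L" for b
    by (intro momentum_states_apply g continuous_intros)
  have "dot_momentum q (plane_wave_superposition g) x = (\<Sum>b\<in>UNIV. app (cscal (of_int (q $ b)))
      (plane_wave_superposition (\<lambda>p. app (cscal (of_real (p $ b))) (g p)) x))"
    unfolding dot_momentum_def momentum_plane_wave_superposition[OF g] by simp
  also have "\<dots> = (\<Sum>b\<in>UNIV. plane_wave_superposition (\<lambda>p. app (cscal (of_int (q $ b)))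
      (app (cscal (of_real (p $ b))) (g p))) x)"
    by (intro sum.cong refl plane_wave_superposition_apply[OF pg, symmetric] complex_linear_cscal)
  also have "\<dots> = plane_wave_superposition (\<lambda>p. \<Sum>b\<in>UNIV. app (cscal (of_int (q $ b)))
      (app (cscal (of_real (p $ b))) (g p))) x"
    by (intro plane_wave_superposition_sum[symmetric, where L=L] momentum_states_apply g continuous_intros) simp
  also have "(\<lambda>p. \<Sum>b\<in>UNIV. app (cscal (of_int (q $ b))) (app (cscal (of_real (p $ b))) (g p)))
      = (\<lambda>p. app (cscal (of_real (p \<bullet> lattice_point q))) (g p))"
    by (auto simp: vec_eq_iff inner_vec_def lattice_point_def sum_distrib_left sum_distrib_right mult_ac)
  finally show "dot_momentum q (plane_wave_superposition g) x
    = plane_wave_superposition (\<lambda>p. app (cscal (of_real (p \<bullet> lattice_point q))) (g p)) x" .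
qed

text \<open>T maps superpositions to superpositions within the same box, so its powers become powers
  of the symbol; complex linearity lets z pass through M p, giving (z M p)^n = z^n (M p)^n. Partial
  sums are dominated by exp R on the compact box, hence they converge at each x, which is the
  convergence that \<open>op_exp\<close> refers to.\<close>

lemma op_exp_plane_wave_superposition:
  assumes T: "\<And>g. g \<in> momentum_states L \<Longrightarrow>
      T (plane_wave_superposition g) = plane_wave_superposition (\<lambda>p. app (M p) (g p))"
    and M: "continuous_on (momentum_box L) M" and lin: "\<And>p. complex_linear (M p)"
    and g: "g \<in> momentum_states L"
  shows "op_exp z T (plane_wave_superposition g) = plane_wave_superposition (\<lambda>p. app (exp (cscal z * M p)) (g p))"
proof
  fix x
  have pow: "(T ^^ n) (plane_wave_superposition g) = plane_wave_superposition (\<lambda>p. app (M p ^ n) (g p))" for n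
    by (induction n) (simp_all add: T momentum_states_apply[OF g] continuous_on_power[OF M])
  have tm: "(z ^ n / fact n) *s (T ^^ n) (plane_wave_superposition g) x
      = plane_wave_superposition (\<lambda>p. app (((cscal z * M p) ^ n) /\<^sub>R fact n) (g p)) x" for n
  proof -
    have mult_pow: "(cscal z * M p) ^ n = cscal z ^ n * M p ^ n" for p
    proof (induction n)
      case (Suc n)
      have "M p * cscal z ^ n = cscal z ^ n * M p"
        using lin[of p] by (simp add: complex_linear_def cscal_power[symmetric])
      then show ?case by (simp add: Suc mult.assoc) (simp add: mult.assoc[symmetric])
    qed simp
    have eq: "((cscal z * M p) ^ n) /\<^sub>R fact n = cscal (z ^ n / fact n) * M p ^ n" for p
    proof -
      have "z ^ n / fact n = inverse (fact n) *\<^sub>R z ^ n"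
        by (simp add: scaleR_conv_of_real field_simps)
      then show ?thesis by (simp add: mult_pow cscal_scaleR cscal_power)
    qed
    have Mg: "(\<lambda>p. app (M p ^ n) (g p)) \<in> momentum_states L"
      by (intro momentum_states_apply g continuous_on_power M)
    show ?thesis
      unfolding pow eq app_mult plane_wave_superposition_apply[OF Mg complex_linear_cscal] by simp
  qed
  have cM: "continuous_on (momentum_box L) (\<lambda>p. cscal z * M p)"
    by (intro continuous_intros M)
  have "bounded ((\<lambda>p. cscal z * M p) ` momentum_box L)"
    by (intro compact_imp_bounded compact_continuous_image cM compact_momentum_box)
  then obtain R where R: "\<And>p. p \<in> momentum_box L \<Longrightarrow> norm (cscal z * M p) \<le> R"
    by (auto simp: bounded_iff)
  have "(\<lambda>N. plane_wave_superposition (\<lambda>p. app (\<Sum>n<N. ((cscal z * M p) ^ n) /\<^sub>R fact n) (g p)) x)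
      \<longlonglongrightarrow> plane_wave_superposition (\<lambda>p. app (exp (cscal z * M p)) (g p)) x"
  proof (rule plane_wave_superposition_tendsto[OF g, where B="exp R"])
    show "continuous_on (momentum_box L) (\<lambda>p. \<Sum>n<k. ((cscal z * M p) ^ n) /\<^sub>R fact n)" for k
      by (intro continuous_intros M)
    show "continuous_on (momentum_box L) (\<lambda>p. exp (cscal z * M p))"
      by (rule continuous_on_exp_momentum_box[OF cM])
    fix p :: "real ^ 'a" assume p: "p \<in> momentum_box L"
    show "norm (\<Sum>n<k. ((cscal z * M p) ^ n) /\<^sub>R fact n) \<le> exp R" for k
    proof -
      have R0: "0 \<le> R" using order_trans[OF norm_ge_zero R[OF p]] .
      have "norm (\<Sum>n<k. ((cscal z * M p) ^ n) /\<^sub>R fact n) \<le> (\<Sum>n<k. R ^ n /\<^sub>R fact n)"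
      proof (rule sum_norm_le)
        fix n
        have "norm ((cscal z * M p) ^ n) \<le> R ^ n"
          by (intro order_trans[OF norm_power_ineq] power_mono R p norm_ge_zero)
        then show "norm (((cscal z * M p) ^ n) /\<^sub>R fact n) \<le> R ^ n /\<^sub>R fact n" by (simp add: mult_left_mono)
      qed
      also have "\<dots> \<le> (\<Sum>n. R ^ n /\<^sub>R fact n)"
        using R0 by (intro sum_le_suminf summable_exp_generic) auto
      finally show ?thesis by (simp add: exp_def)
    qed
    show "(\<lambda>k. \<Sum>n<k. ((cscal z * M p) ^ n) /\<^sub>R fact n) \<longlonglongrightarrow> exp (cscal z * M p)"
      using exp_converges[of "cscal z * M p"] by (simp add: sums_def)
  qed
  moreover have "plane_wave_superposition (\<lambda>p. app (\<Sum>n<N. ((cscal z * M p) ^ n) /\<^sub>R fact n) (g p)) x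
      = (\<Sum>n<N. (z ^ n / fact n) *s (T ^^ n) (plane_wave_superposition g) x)" for N
    unfolding tm app.sum_left
    by (intro plane_wave_superposition_sum[where L=L] momentum_states_apply g continuous_intros M) simp
  ultimately have "(\<lambda>n. (z ^ n / fact n) *s (T ^^ n) (plane_wave_superposition g) x)
      sums plane_wave_superposition (\<lambda>p. app (exp (cscal z * M p)) (g p)) x"
    by (simp add: sums_def)
  then show "op_exp z T (plane_wave_superposition g) x
      = plane_wave_superposition (\<lambda>p. app (exp (cscal z * M p)) (g p)) x"
    unfolding op_exp_def by (rule sums_unique[symmetric])
qed

text \<open>The exponential of -i a (p . q) is a character, so the power series in
  \<open>continuum_walk\<close> sums to the translation by a q. This links the momentum operators to
  the translation form on which lattice unitarity was used.\<close>

lemma continuum_walk_plane_wave_superposition: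
  assumes g: "g \<in> momentum_states L" and "finite Q"
  shows "continuum_walk Q A a (plane_wave_superposition g)
    = plane_wave_superposition (\<lambda>p. app (walk_symbol Q A a p) (g p))"
proof
  fix x
  have "op_exp (- \<i> * of_real a) (dot_momentum q) (plane_wave_superposition g) x
      = plane_wave_superposition g (x - a *\<^sub>R lattice_point q)" for q
  proof -
    have "op_exp (- \<i> * of_real a) (dot_momentum q) (plane_wave_superposition g)
        = plane_wave_superposition (\<lambda>p. app (exp (cscal (- \<i> * of_real a) * cscal (of_real (p \<bullet> lattice_point q)))) (g p))"
      by (rule op_exp_plane_wave_superposition[OF dot_momentum_plane_wave_superposition _ _ g])
        (auto intro!: continuous_intros)
    also have "\<dots> = plane_wave_superposition (\<lambda>p. app (cscal (cis (p \<bullet> (- a *\<^sub>R lattice_point q)))) (g p))"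
      by (simp only: cscal_mult[symmetric] cscal_exp[symmetric] cis_conv_exp)
        (simp add: mult.assoc)
    finally have eq: "op_exp (- \<i> * of_real a) (dot_momentum q) (plane_wave_superposition g)
        = plane_wave_superposition (\<lambda>p. app (cscal (cis (p \<bullet> (- a *\<^sub>R lattice_point q)))) (g p))" .
    show ?thesis unfolding eq plane_wave_superposition_translate by simp
  qed
  then show "continuum_walk Q A a (plane_wave_superposition g) x
    = plane_wave_superposition (\<lambda>p. app (walk_symbol Q A a p) (g p)) x"
    by (simp add: continuum_walk_def plane_wave_superposition_walk_symbol[OF assms])
qed

lemma continuum_walk_power_plane_wave_superposition:
  assumes g: "g \<in> momentum_states L" and "finite Q"
  shows "(continuum_walk Q A a ^^ n) (plane_wave_superposition g)
    = plane_wave_superposition (\<lambda>p. app (walk_symbol Q A a p ^ n) (g p))"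
proof (induction n)
  case (Suc n)
  have "(\<lambda>p. app (walk_symbol Q A a p ^ n) (g p)) \<in> momentum_states L"
    by (intro momentum_states_apply g continuous_intros)
  then show ?case
    by (simp add: Suc continuum_walk_plane_wave_superposition assms(2))
qed simp

definition hamiltonian_symbol ::
    "(int ^ 'd) set \<Rightarrow> (int ^ 'd \<Rightarrow> complex ^ 'c ^ 'c) \<Rightarrow> real ^ 'd \<Rightarrow> (complex ^ 'c) endo" where
  "hamiltonian_symbol Q A p = (\<Sum>q\<in>Q. endo_of_matrix (A q) * cscal (of_real (p \<bullet> lattice_point q)))"

lemma continuous_on_hamiltonian_symbol [continuous_intros]: "continuous_on S (hamiltonian_symbol Q A)"
  unfolding hamiltonian_symbol_def by (intro continuous_intros)

lemma complex_linear_hamiltonian_symbol: "complex_linear (hamiltonian_symbol Q A p)"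
proof -
  have "endo_of_matrix (A q) * cscal w * cscal z = cscal z * (endo_of_matrix (A q) * cscal w)" for q w z
  proof -
    have "endo_of_matrix (A q) * (cscal z * cscal w) = cscal z * endo_of_matrix (A q) * cscal w"
      using complex_linear_endo_of_matrix[of "A q"] by (simp add: complex_linear_def mult.assoc[symmetric])
    then show ?thesis by (simp add: mult.assoc cscal_mult[symmetric] mult.commute[of w])
  qed
  then show ?thesis
    by (simp add: complex_linear_def hamiltonian_symbol_def sum_distrib_left sum_distrib_right)
qed

lemma hamiltonian_plane_wave_superposition:
  assumes g: "g \<in> momentum_states L" and fin: "finite Q"
  shows "hamiltonian Q A (plane_wave_superposition g)
    = plane_wave_superposition (\<lambda>p. app (hamiltonian_symbol Q A p) (g p))"
proof
  fix x
  have qg: "(\<lambda>p. app (cscal (of_real (p \<bullet> lattice_point q))) (g p)) \<in> momentum_states L" for q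
    by (intro momentum_states_apply g continuous_intros)
  have "hamiltonian Q A (plane_wave_superposition g) x = (\<Sum>q\<in>Q. app (endo_of_matrix (A q))
      (plane_wave_superposition (\<lambda>p. app (cscal (of_real (p \<bullet> lattice_point q))) (g p)) x))"
    unfolding hamiltonian_def dot_momentum_plane_wave_superposition[OF g] app_endo_of_matrix ..
  also have "\<dots> = (\<Sum>q\<in>Q. plane_wave_superposition (\<lambda>p. app (endo_of_matrix (A q))
      (app (cscal (of_real (p \<bullet> lattice_point q))) (g p))) x)"
    by (intro sum.cong refl plane_wave_superposition_apply[OF qg, symmetric] complex_linear_endo_of_matrix)
  also have "\<dots> = plane_wave_superposition (\<lambda>p. \<Sum>q\<in>Q. app (endo_of_matrix (A q))
      (app (cscal (of_real (p \<bullet> lattice_point q))) (g p))) x"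
    by (intro plane_wave_superposition_sum[symmetric, where L=L] momentum_states_apply g continuous_intros fin)
  also have "\<dots> = plane_wave_superposition (\<lambda>p. app (hamiltonian_symbol Q A p) (g p)) x"
    by (simp only: hamiltonian_symbol_def app.sum_left app_mult)
  finally show "hamiltonian Q A (plane_wave_superposition g) x
    = plane_wave_superposition (\<lambda>p. app (hamiltonian_symbol Q A p) (g p)) x" .
qed


section \<open>Comparison of the walk with the Hamiltonian evolution\<close>

lemma sum_endo_of_matrix:
  assumes "(\<Sum>q\<in>Q. A q) = mat 1"
  shows "(\<Sum>q\<in>Q. endo_of_matrix (A q)) = 1"
proof (rule endo_eqI)
  fix v
  have "(\<Sum>q\<in>Q. A q *v v) = (\<Sum>q\<in>Q. A q) *v v"
    by (induction Q rule: infinite_finite_induct) (simp_all add: matrix_vector_mult_add_rdistrib)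
  then show "app (\<Sum>q\<in>Q. endo_of_matrix (A q)) v = app 1 v"
    by (simp add: app.sum_left assms)
qed

lemma abs_inner_momentum_box_le:
  assumes "p \<in> momentum_box L"
  shows "\<bar>p \<bullet> y\<bar> \<le> L * (\<Sum>b\<in>UNIV. \<bar>y $ b\<bar>)"
proof -
  have "\<bar>p \<bullet> y\<bar> \<le> (\<Sum>b\<in>UNIV. \<bar>p $ b * y $ b\<bar>)" by (simp add: inner_vec_def sum_abs)
  also have "\<dots> \<le> (\<Sum>b\<in>UNIV. L * \<bar>y $ b\<bar>)"
    using assms by (intro sum_mono) (simp add: abs_mult momentum_box_def mult_right_mono)
  finally show ?thesis by (simp add: sum_distrib_left)
qed

text \<open>The l1 length is the one produced by summing the Bernstein bound over coordinates in
  \<open>multiplier_le_inner\<close>.\<close>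

definition hop_length :: "int ^ 'd \<Rightarrow> real" where
  "hop_length q = (\<Sum>b\<in>UNIV. \<bar>lattice_point q $ b\<bar>)"

lemma hop_length_nonneg: "0 \<le> hop_length q"
  by (simp add: hop_length_def sum_nonneg)

text \<open>Collects the two error terms of one halving step, the square of the bound on B and the
  bound on the sum of A_q D_q^2. Each D_q contributes pi L s \<open>hop_length q\<close>; the common
  factor (L s)^2 is split off.\<close>

definition halving_const :: "(int ^ 'd) set \<Rightarrow> (int ^ 'd \<Rightarrow> complex ^ 'c ^ 'c) \<Rightarrow> real" where
  "halving_const Q A = pi\<^sup>2 * ((\<Sum>q\<in>Q. norm (endo_of_matrix (A q)) * hop_length q)\<^sup>2
     + (\<Sum>q\<in>Q. norm (endo_of_matrix (A q)) * (hop_length q)\<^sup>2))"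

lemma halving_const_nonneg: "0 \<le> halving_const Q A"
  unfolding halving_const_def by (intro mult_nonneg_nonneg add_nonneg_nonneg sum_nonneg) auto

text \<open>With \<open>D\<^sub>q = T\<^sub>q - 1\<close> for the translations \<open>T\<^sub>q\<close> of the walk of spacing \<open>s\<close>, and
  \<open>B = \<Sum> A\<^sub>q D\<^sub>q\<close>, masslessness gives \<open>U\<^sub>s = 1 + B\<close> and \<open>U\<^sub>s\<^sup>2 - U\<^sub>2\<^sub>s = B\<^sup>2 - \<Sum> A\<^sub>q D\<^sub>q\<^sup>2\<close>.\<close>

lemma multiplier_le_halving:
  fixes Q :: "(int ^ 'd::finite) set" and A :: "int ^ 'd \<Rightarrow> complex ^ 'c ^ 'c::finite"
  assumes fin: "finite Q" and one: "(\<Sum>q\<in>Q. A q) = mat 1" and L: "0 < L" and s: "0 < s"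
    and small: "L * (pi / 2) * s * (\<Sum>q\<in>Q. hop_length q) \<le> 1"
  shows "multiplier_le L (\<lambda>p. walk_symbol Q A s p ^ 2 - walk_symbol Q A (2 * s) p) (halving_const Q A * (L * s)\<^sup>2)"
proof -
  define D where "D q p = (cscal (cis (p \<bullet> (- s *\<^sub>R lattice_point q))) - 1 :: (complex ^ 'c) endo)" for q and p :: "real ^ 'd"
  define B where "B p = (\<Sum>q\<in>Q. endo_of_matrix (A q) * D q p)" for p
  have D: "multiplier_le L (D q) (L * pi * s * hop_length q)" if "q \<in> Q" for q
  proof -
    have len: "(\<Sum>b\<in>UNIV. \<bar>(- s *\<^sub>R lattice_point q) $ b\<bar>) = s * hop_length q"
      using s by (simp add: hop_length_def abs_mult sum_distrib_left)
    have "hop_length q \<le> (\<Sum>q\<in>Q. hop_length q)"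
      using fin that by (intro member_le_sum hop_length_nonneg)
    then have "L * (pi / 2) * s * hop_length q \<le> L * (pi / 2) * s * (\<Sum>q\<in>Q. hop_length q)"
      using L s by (intro mult_left_mono) auto
    then have "L * (pi / 2) * (s * hop_length q) \<le> 1" using small by (simp add: mult.assoc)
    then show ?thesis
      using multiplier_le_translation_diff[of L "- s *\<^sub>R lattice_point q"] L
      unfolding D_def len by (simp add: mult.assoc)
  qed
  have Aq: "multiplier_le L (\<lambda>_. endo_of_matrix (A q)) (norm (endo_of_matrix (A q)))" for q
    by (intro multiplier_le_const) simp
  have B: "multiplier_le L B (\<Sum>q\<in>Q. norm (endo_of_matrix (A q)) * (L * pi * s * hop_length q))"
    unfolding B_def by (intro multiplier_le_sum fin multiplier_le_mult Aq D)
  have "multiplier_le L (\<lambda>p. B p ^ 2 - (\<Sum>q\<in>Q. endo_of_matrix (A q) * D q p ^ 2))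
      ((\<Sum>q\<in>Q. norm (endo_of_matrix (A q)) * (L * pi * s * hop_length q)) ^ 2
        + (\<Sum>q\<in>Q. norm (endo_of_matrix (A q)) * (L * pi * s * hop_length q) ^ 2))"
    by (intro multiplier_le_diff multiplier_le_power B multiplier_le_sum fin multiplier_le_mult Aq D)
  moreover have "(\<Sum>q\<in>Q. norm (endo_of_matrix (A q)) * (L * pi * s * hop_length q)) ^ 2
        + (\<Sum>q\<in>Q. norm (endo_of_matrix (A q)) * (L * pi * s * hop_length q) ^ 2)
      = halving_const Q A * (L * s)\<^sup>2"
  proof -
    have "(\<Sum>q\<in>Q. norm (endo_of_matrix (A q)) * (L * pi * s * hop_length q))
        = L * pi * s * (\<Sum>q\<in>Q. norm (endo_of_matrix (A q)) * hop_length q)"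
      by (simp add: sum_distrib_left mult_ac)
    moreover have "(\<Sum>q\<in>Q. norm (endo_of_matrix (A q)) * (L * pi * s * hop_length q) ^ 2)
        = (L * pi * s)\<^sup>2 * (\<Sum>q\<in>Q. norm (endo_of_matrix (A q)) * (hop_length q)\<^sup>2)"
      by (simp add: sum_distrib_left mult_ac power_mult_distrib)
    ultimately show ?thesis
      by (simp add: halving_const_def power_mult_distrib algebra_simps)
  qed
  moreover have "B p ^ 2 - (\<Sum>q\<in>Q. endo_of_matrix (A q) * D q p ^ 2)
      = walk_symbol Q A s p ^ 2 - walk_symbol Q A (2 * s) p" for p
  proof -
    have w: "walk_symbol Q A s p = 1 + B p"
      by (simp add: walk_symbol_def B_def D_def right_diff_distrib sum_subtractf sum_endo_of_matrix[OF one])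
    have "cscal (cis (p \<bullet> (- (2 * s) *\<^sub>R lattice_point q))) = (1 + D q p) ^ 2" for q
      by (simp add: D_def power2_eq_square cscal_mult[symmetric] cis_mult mult.assoc)
    then have "walk_symbol Q A (2 * s) p = (\<Sum>q\<in>Q. endo_of_matrix (A q) * (1 + D q p) ^ 2)"
      unfolding walk_symbol_def by (simp only: mult_minus_left)
    also have "\<dots> = (\<Sum>q\<in>Q. endo_of_matrix (A q) + (endo_of_matrix (A q) * D q p + endo_of_matrix (A q) * D q p)
        + endo_of_matrix (A q) * D q p ^ 2)"
      by (intro sum.cong refl) (simp add: power2_eq_square algebra_simps)
    also have "\<dots> = 1 + (B p + B p) + (\<Sum>q\<in>Q. endo_of_matrix (A q) * D q p ^ 2)"
      by (simp add: sum.distrib B_def sum_endo_of_matrix[OF one])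
    finally show ?thesis by (simp add: w power2_eq_square algebra_simps)
  qed
  ultimately show ?thesis by simp
qed

text \<open>Let X = \<open>halving_const Q A\<close> L^2 N a^2. Refining a/2^k to a/2^(k+1) involves
  2^k N steps, each with error \<open>halving_const Q A\<close> (L a / 2^(k+1))^2, in total X / (4 *
  2^k). This is relaxed to X / 2^k, the exact increment of X (2 - 2/2^k), so the bound stays below
  2X for all k.\<close>

lemma multiplier_le_dyadic:
  fixes Q :: "(int ^ 'd::finite) set" and A :: "int ^ 'd \<Rightarrow> complex ^ 'c ^ 'c::finite"
  assumes walk: "massless_walk Q A" and L: "0 < L" and a: "0 < a"
    and small: "L * (pi / 2) * a * (\<Sum>q\<in>Q. hop_length q) \<le> 1"
  shows "multiplier_le L (\<lambda>p. walk_symbol Q A (a / 2 ^ k) p ^ (2 ^ k * N) - walk_symbol Q A a p ^ N)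
    (halving_const Q A * L\<^sup>2 * real N * a\<^sup>2 * (2 - 2 / 2 ^ k))"
proof (induction k)
  case 0
  then show ?case by (simp add: multiplier_le_0)
next
  case (Suc k)
  have fin: "finite Q" and one: "(\<Sum>q\<in>Q. A q) = mat 1"
    using walk by (auto simp: massless_walk_def)
  define s where "s = a / 2 ^ Suc k"
  have s: "0 < s" "2 * s = a / 2 ^ k" using a by (simp_all add: s_def)
  have "1 \<le> (2::real) ^ Suc k" by (rule one_le_power) simp
  then have "s \<le> a / 1" unfolding s_def using a by (intro divide_left_mono) auto
  then have "s \<le> a" by simp
  then have "L * (pi / 2) * s * (\<Sum>q\<in>Q. hop_length q) \<le> L * (pi / 2) * a * (\<Sum>q\<in>Q. hop_length q)"
    using L by (intro mult_right_mono mult_left_mono sum_nonneg hop_length_nonneg) auto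
  then have "L * (pi / 2) * s * (\<Sum>q\<in>Q. hop_length q) \<le> 1" using small by simp
  note halving = multiplier_le_halving[OF fin one L s(1) this]
  have w: "multiplier_le L (walk_symbol Q A r) 1" if "0 < r" for r
    by (rule multiplier_le_walk_symbol[OF walk that])
  have w2: "multiplier_le L (\<lambda>p. walk_symbol Q A s p ^ 2) 1"
    using multiplier_le_power[OF w[OF s(1)], of 2] by simp
  have "multiplier_le L (\<lambda>p. (walk_symbol Q A s p ^ 2) ^ (2 ^ k * N) - walk_symbol Q A (2 * s) p ^ (2 ^ k * N))
      (real (2 ^ k * N) * (halving_const Q A * (L * s)\<^sup>2))"
    using s(1) by (intro multiplier_le_power_diff halving w w2) simp
  from multiplier_le_add[OF this Suc.IH]
  have "multiplier_le L (\<lambda>p. walk_symbol Q A s p ^ (2 ^ Suc k * N) - walk_symbol Q A a p ^ N)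
      (real (2 ^ k * N) * (halving_const Q A * (L * s)\<^sup>2)
        + halving_const Q A * L\<^sup>2 * real N * a\<^sup>2 * (2 - 2 / 2 ^ k))"
    unfolding s(2) by (simp add: power_mult[symmetric] mult.assoc)
  then show ?case
    unfolding s_def
  proof (rule multiplier_le_mono)
    define X where "X = halving_const Q A * L\<^sup>2 * real N * a\<^sup>2"
    have X: "0 \<le> X" unfolding X_def by (intro mult_nonneg_nonneg halving_const_nonneg) auto
    have "real (2 ^ k * N) * (halving_const Q A * (L * (a / 2 ^ Suc k))\<^sup>2) = X / 2 ^ k / 4"
      by (simp add: X_def power_mult_distrib power_divide field_simps power2_eq_square)
    also have "\<dots> \<le> X / 2 ^ k" using X by (simp add: field_simps)
    finally have "real (2 ^ k * N) * (halving_const Q A * (L * (a / 2 ^ Suc k))\<^sup>2) + X * (2 - 2 / 2 ^ k)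
        \<le> X / 2 ^ k + X * (2 - 2 / 2 ^ k)" by simp
    also have "\<dots> = X * (2 - 2 / 2 ^ Suc k)" by (simp add: field_simps)
    finally show "real (2 ^ k * N) * (halving_const Q A * (L * (a / 2 ^ Suc k))\<^sup>2)
        + halving_const Q A * L\<^sup>2 * real N * a\<^sup>2 * (2 - 2 / 2 ^ k)
        \<le> halving_const Q A * L\<^sup>2 * real N * a\<^sup>2 * (2 - 2 / 2 ^ Suc k)"
      by (simp only: X_def)
  qed
qed

section \<open>Pointwise behaviour of the symbols under refinement\<close>

lemma norm_walk_symbol_diff_le:
  fixes Q :: "(int ^ 'd::finite) set" and A :: "int ^ 'd \<Rightarrow> complex ^ 'c ^ 'c::finite"
  assumes one: "(\<Sum>q\<in>Q. A q) = mat 1" and s: "0 < s" and p: "p \<in> momentum_box L"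
  shows "norm (walk_symbol Q A s p - 1) \<le> s * (L * (\<Sum>q\<in>Q. norm (endo_of_matrix (A q)) * hop_length q))"
proof -
  have "walk_symbol Q A s p - 1
      = (\<Sum>q\<in>Q. endo_of_matrix (A q) * cscal (cis (p \<bullet> (- s *\<^sub>R lattice_point q)) - 1))"
    by (simp add: walk_symbol_def cscal_diff right_diff_distrib sum_subtractf sum_endo_of_matrix[OF one])
  also have "norm \<dots> \<le> (\<Sum>q\<in>Q. norm (endo_of_matrix (A q)) * (s * L * hop_length q))"
  proof (rule sum_norm_le)
    fix q assume "q \<in> Q"
    have "norm (cscal (cis (p \<bullet> (- s *\<^sub>R lattice_point q)) - 1) :: (complex ^ 'c) endo) \<le> \<bar>p \<bullet> (- s *\<^sub>R lattice_point q)\<bar>"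
      by (rule order_trans[OF norm_cscal_le norm_cis_minus_one_le])
    also have "\<dots> = s * \<bar>p \<bullet> lattice_point q\<bar>" using s by (simp add: abs_mult)
    also have "\<dots> \<le> s * (L * hop_length q)"
      unfolding hop_length_def using s by (intro mult_left_mono abs_inner_momentum_box_le p) simp
    finally show "norm (endo_of_matrix (A q) * cscal (cis (p \<bullet> (- s *\<^sub>R lattice_point q)) - 1))
        \<le> norm (endo_of_matrix (A q)) * (s * L * hop_length q)"
      by (intro order_trans[OF norm_mult_ineq] mult_left_mono) (simp_all add: mult.assoc)
  qed
  also have "\<dots> = s * (L * (\<Sum>q\<in>Q. norm (endo_of_matrix (A q)) * hop_length q))"
    by (simp add: sum_distrib_left mult_ac)
  finally show ?thesis .
qed

text \<open>With s = a/2^k the exponent 2^k N is t/s. By masslessness U_s - 1 is the sum of A_q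
  (e^(-i s p . q) - 1), and multiplied by t/s it tends to -i t times the symbol of H. The
  non-commutative compound-interest limit then gives the exponential.\<close>

lemma walk_symbol_power_tendsto:
  fixes Q :: "(int ^ 'd::finite) set" and A :: "int ^ 'd \<Rightarrow> complex ^ 'c ^ 'c::finite"
  assumes one: "(\<Sum>q\<in>Q. A q) = mat 1" and a: "0 < a" and t: "real N * a = t" and N: "0 < N"
  shows "(\<lambda>k. walk_symbol Q A (a / 2 ^ k) p ^ (2 ^ k * N))
    \<longlonglongrightarrow> exp (cscal (- \<i> * of_real t) * hamiltonian_symbol Q A p)"
proof (rule tendsto_power_exp)
  show n: "filterlim (\<lambda>k. 2 ^ k * N) at_top sequentially"
  proof (rule filterlim_at_top_mono[OF filterlim_ident])
    have le: "k * 1 \<le> 2 ^ k * N" for k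
      using N less_imp_le[OF less_exp[of k]] by (intro mult_le_mono) auto
    show "\<forall>\<^sub>F k in sequentially. k \<le> 2 ^ k * N"
      by (intro always_eventually allI le[unfolded mult_1_right])
  qed
  have lim: "(\<lambda>k. real (2 ^ k * N) *\<^sub>R (cis (p \<bullet> (- (a / 2 ^ k) *\<^sub>R lattice_point q)) - 1))
      \<longlonglongrightarrow> - \<i> * of_real t * of_real (p \<bullet> lattice_point q)" for q
  proof -
    define x where "x = - \<i> * of_real t * of_real (p \<bullet> lattice_point q)"
    have "cis (p \<bullet> (- (a / 2 ^ k) *\<^sub>R lattice_point q)) = exp (x /\<^sub>R real (2 ^ k * N))" for k
    proof -
      define y where "y = p \<bullet> lattice_point q"
      have "inverse (real (2 ^ k * N)) * (- (t * y)) = - (a / 2 ^ k) * y"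
        using N by (simp add: t[symmetric] field_simps)
      moreover have "x = \<i> * of_real (- (t * y))" by (simp add: x_def y_def)
      moreover have "r *\<^sub>R (\<i> * of_real c) = \<i> * of_real (r * c)" for r c
        by (simp add: scaleR_conv_of_real)
      ultimately have "x /\<^sub>R real (2 ^ k * N) = \<i> * of_real (- (a / 2 ^ k) * y)"
        by (simp only:)
      moreover have "p \<bullet> (- (a / 2 ^ k) *\<^sub>R lattice_point q) = - (a / 2 ^ k) * y"
        by (simp only: y_def inner_scaleR_right)
      ultimately show ?thesis by (simp only: cis_conv_exp)
    qed
    then show ?thesis
      unfolding x_def[symmetric] using tendsto_exp_scaled[OF n, of x] by simp
  qed
  have "(\<lambda>k. \<Sum>q\<in>Q. endo_of_matrix (A q) * cscal (real (2 ^ k * N) *\<^sub>R (cis (p \<bullet> (- (a / 2 ^ k) *\<^sub>R lattice_point q)) - 1)))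
      \<longlonglongrightarrow> (\<Sum>q\<in>Q. endo_of_matrix (A q) * cscal (- \<i> * of_real t * of_real (p \<bullet> lattice_point q)))"
    by (intro tendsto_intros bounded_linear.tendsto[OF bounded_linear_cscal] lim)
  moreover have "(\<Sum>q\<in>Q. endo_of_matrix (A q) * cscal (real (2 ^ k * N) *\<^sub>R (cis (p \<bullet> (- (a / 2 ^ k) *\<^sub>R lattice_point q)) - 1)))
      = real (2 ^ k * N) *\<^sub>R (walk_symbol Q A (a / 2 ^ k) p - 1)" for k
    unfolding walk_symbol_def sum_endo_of_matrix[OF one, symmetric] sum_subtractf[symmetric] scaleR_sum_right
    by (intro sum.cong refl) (simp only: cscal_scaleR cscal_diff cscal_1 mult_scaleR_right right_diff_distrib mult_1_right)
  moreover have "(\<Sum>q\<in>Q. endo_of_matrix (A q) * cscal (- \<i> * of_real t * of_real (p \<bullet> lattice_point q)))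
      = cscal (- \<i> * of_real t) * hamiltonian_symbol Q A p"
    unfolding hamiltonian_symbol_def sum_distrib_left
  proof (intro sum.cong refl)
    fix q
    have "endo_of_matrix (A q) * cscal (- \<i> * of_real t) = cscal (- \<i> * of_real t) * endo_of_matrix (A q)"
      using complex_linear_endo_of_matrix[of "A q"] unfolding complex_linear_def by blast
    then show "endo_of_matrix (A q) * cscal (- \<i> * of_real t * of_real (p \<bullet> lattice_point q))
        = cscal (- \<i> * of_real t) * (endo_of_matrix (A q) * cscal (of_real (p \<bullet> lattice_point q)))"
      unfolding cscal_mult[of "- \<i> * of_real t"] mult.assoc[symmetric] by simp
  qed
  ultimately show "(\<lambda>k. real (2 ^ k * N) *\<^sub>R (walk_symbol Q A (a / 2 ^ k) p - 1))
      \<longlonglongrightarrow> cscal (- \<i> * of_real t) * hamiltonian_symbol Q A p"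
    by simp
qed

text \<open>Here a and N stay fixed while k tends to infinity; the dyadic bound is uniform in k. Its
  limit value contains N a^2 = t a, which explains the factor 2 t L^2 a.\<close>

lemma multiplier_le_evolution_diff:
  fixes Q :: "(int ^ 'd::finite) set" and A :: "int ^ 'd \<Rightarrow> complex ^ 'c ^ 'c::finite"
  assumes walk: "massless_walk Q A" and L: "0 < L" and a: "0 < a" and t: "real N * a = t" and N: "0 < N"
    and small: "L * (pi / 2) * a * (\<Sum>q\<in>Q. hop_length q) \<le> 1"
  shows "multiplier_le L (\<lambda>p. exp (cscal (- \<i> * of_real t) * hamiltonian_symbol Q A p) - walk_symbol Q A a p ^ N)
    (2 * t * halving_const Q A * (L\<^sup>2 * a))"
proof -
  have one: "(\<Sum>q\<in>Q. A q) = mat 1" using walk by (auto simp: massless_walk_def)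
  define c where "c = L * (\<Sum>q\<in>Q. norm (endo_of_matrix (A q)) * hop_length q)"
  \<comment> \<open>Bounding each factor by exp(norm(U - 1)) makes the product bound independent of
    k, because the number of factors times the spacing is always t. It is exponential in L but
    serves only as the dominating constant.\<close>
  have pow: "norm (walk_symbol Q A (a / 2 ^ k) p ^ (2 ^ k * N)) \<le> exp (t * c)" if "p \<in> momentum_box L" for p k
  proof -
    have "norm (walk_symbol Q A (a / 2 ^ k) p ^ (2 ^ k * N))
        \<le> exp (real (2 ^ k * N) * norm (walk_symbol Q A (a / 2 ^ k) p - 1))"
      by (rule norm_power_le_exp)
    also have "\<dots> \<le> exp (real (2 ^ k * N) * (a / 2 ^ k * c))"
      unfolding c_def exp_le_cancel_iff using a by (intro mult_left_mono norm_walk_symbol_diff_le one that) auto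
    also have "real (2 ^ k * N) * (a / 2 ^ k * c) = t * c" using t by simp
    finally show ?thesis .
  qed
  show ?thesis
  proof (rule multiplier_le_limit[where B="exp (t * c) + exp (t * c)"])
    show "multiplier_le L (\<lambda>p. walk_symbol Q A (a / 2 ^ k) p ^ (2 ^ k * N) - walk_symbol Q A a p ^ N)
        (2 * t * halving_const Q A * (L\<^sup>2 * a))" for k
    proof (rule multiplier_le_mono[OF multiplier_le_dyadic[OF walk L a small]])
      have "halving_const Q A * L\<^sup>2 * real N * a\<^sup>2 * (2 - 2 / 2 ^ k) \<le> halving_const Q A * L\<^sup>2 * real N * a\<^sup>2 * 2"
        by (intro mult_left_mono mult_nonneg_nonneg halving_const_nonneg) auto
      also have "\<dots> = 2 * t * halving_const Q A * (L\<^sup>2 * a)"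
        using t by (simp add: power2_eq_square)
      finally show "halving_const Q A * L\<^sup>2 * real N * a\<^sup>2 * (2 - 2 / 2 ^ k) \<le> 2 * t * halving_const Q A * (L\<^sup>2 * a)" .
    qed
    show "continuous_on (momentum_box L) (\<lambda>p. exp (cscal (- \<i> * of_real t) * hamiltonian_symbol Q A p) - walk_symbol Q A a p ^ N)"
      by (intro continuous_on_diff continuous_on_exp_momentum_box continuous_intros)
    fix p :: "real ^ 'd" assume p: "p \<in> momentum_box L"
    show "norm (walk_symbol Q A (a / 2 ^ k) p ^ (2 ^ k * N) - walk_symbol Q A a p ^ N) \<le> exp (t * c) + exp (t * c)" for k
      using pow[OF p, of 0] by (intro norm_triangle_le_diff add_mono pow p) simp
    show "(\<lambda>k. walk_symbol Q A (a / 2 ^ k) p ^ (2 ^ k * N) - walk_symbol Q A a p ^ N)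
        \<longlonglongrightarrow> exp (cscal (- \<i> * of_real t) * hamiltonian_symbol Q A p) - walk_symbol Q A a p ^ N"
      by (intro tendsto_intros walk_symbol_power_tendsto one a t N)
  qed
qed

text \<open>The quantitative form of the theorem: the rate is L^2 a with a factor depending only on
  t, Q and A, so a cutoff that varies with a can be inserted directly.\<close>

lemma cutoff_norm_evolution_diff_le:
  fixes Q :: "(int ^ 'd::finite) set" and A :: "int ^ 'd \<Rightarrow> complex ^ 'c ^ 'c::finite"
  assumes walk: "massless_walk Q A" and L: "0 < L" and a: "0 < a" and t: "real N * a = t" and N: "0 < N"
    and small: "L * (pi / 2) * a * (\<Sum>q\<in>Q. hop_length q) \<le> 1"
  shows "cutoff_norm L (\<lambda>\<psi> x. op_exp (- \<i> * of_real t) (hamiltonian Q A) \<psi> x - (continuum_walk Q A a ^^ N) \<psi> x)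
    \<le> ennreal (2 * t * halving_const Q A * (L\<^sup>2 * a))"
  unfolding cutoff_norm_def
proof (rule SUP_least)
  fix \<psi> :: "('d, 'c) wavefun" assume "\<psi> \<in> {\<psi> \<in> cutoff_states L. L2_norm \<psi> \<le> 1}"
  then obtain g where "g \<in> L2_states" "\<And>p. g p \<noteq> 0 \<Longrightarrow> \<forall>b. \<bar>p $ b\<bar> \<le> L"
    and \<psi>: "\<psi> = plane_wave_superposition g" and le: "L2_norm \<psi> \<le> 1"
    by (auto simp: cutoff_states_def)
  then have g: "g \<in> momentum_states L" by (intro L2_box_momentum_states)
  have fin: "finite Q" using walk by (auto simp: massless_walk_def)
  let ?E = "\<lambda>p. exp (cscal (- \<i> * of_real t) * hamiltonian_symbol Q A p)"
  let ?W = "\<lambda>p. walk_symbol Q A a p ^ N"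
  let ?M = "\<lambda>p. ?E p - ?W p"
  have bound: "multiplier_le L ?M (2 * t * halving_const Q A * (L\<^sup>2 * a))"
    by (rule multiplier_le_evolution_diff[OF assms])
  have E: "op_exp (- \<i> * of_real t) (hamiltonian Q A) \<psi> = plane_wave_superposition (\<lambda>p. app (?E p) (g p))"
    unfolding \<psi> by (rule op_exp_plane_wave_superposition[OF hamiltonian_plane_wave_superposition[OF _ fin]
          continuous_on_hamiltonian_symbol complex_linear_hamiltonian_symbol g])
  have W: "(continuum_walk Q A a ^^ N) \<psi> = plane_wave_superposition (\<lambda>p. app (?W p) (g p))"
    unfolding \<psi> by (rule continuum_walk_power_plane_wave_superposition[OF g fin])
  have Wg: "(\<lambda>p. app (?W p) (g p)) \<in> momentum_states L"
    by (intro momentum_states_apply g continuous_intros)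
  have "plane_wave_superposition (\<lambda>p. app (?M p + ?W p) (g p)) x
      = plane_wave_superposition (\<lambda>p. app (?M p) (g p)) x + plane_wave_superposition (\<lambda>p. app (?W p) (g p)) x" for x
    unfolding app.add_left
    by (rule plane_wave_superposition_add[OF momentum_states_apply[OF g multiplier_leD(1)[OF bound]] Wg])
  then have "(\<lambda>x. op_exp (- \<i> * of_real t) (hamiltonian Q A) \<psi> x - (continuum_walk Q A a ^^ N) \<psi> x)
      = plane_wave_superposition (\<lambda>p. app (?M p) (g p))"
    unfolding E W by (simp add: fun_eq_iff)
  then have "L2_norm (\<lambda>x. op_exp (- \<i> * of_real t) (hamiltonian Q A) \<psi> x - (continuum_walk Q A a ^^ N) \<psi> x)
      \<le> ennreal (2 * t * halving_const Q A * (L\<^sup>2 * a)) * L2_norm \<psi>"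
    using multiplier_leD(3)[OF bound g] by (simp add: \<psi>)
  also have "\<dots> \<le> ennreal (2 * t * halving_const Q A * (L\<^sup>2 * a)) * 1"
    by (intro mult_left_mono le) simp
  finally show "L2_norm (\<lambda>x. op_exp (- \<i> * of_real t) (hamiltonian Q A) \<psi> x - (continuum_walk Q A a ^^ N) \<psi> x)
      \<le> ennreal (2 * t * halving_const Q A * (L\<^sup>2 * a))" by simp
qed

theorem theorem3p4:
  fixes Q :: "(int ^ 'd::finite) set"
    and A :: "int ^ 'd \<Rightarrow> complex ^ 'c ^ 'c::finite"
    and t :: real
    and \<Lambda> :: "real \<Rightarrow> real"
  assumes "massless_walk Q A"
    and "t > 0"
    and "filterlim \<Lambda> at_top (lattice_spacings t)"
    and "((\<lambda>a. (\<Lambda> a)\<^sup>2 * a) \<longlongrightarrow> 0) (lattice_spacings t)"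
  shows "((\<lambda>a. cutoff_norm (\<Lambda> a)
            (\<lambda>\<psi> x. op_exp (- \<i> * of_real t) (hamiltonian Q A) \<psi> x
                     - (continuum_walk Q A a ^^ nat \<lfloor>t / a\<rfloor>) \<psi> x))
          \<longlongrightarrow> 0) (lattice_spacings t)"
proof -
  define K where "K = 2 * t * halving_const Q A"
  \<comment> \<open>Once \<Lambda> >= 1, one has \<Lambda> a <= \<Lambda>^2 a, so \<Lambda>^2 a <
    1/\<rho> implies the smallness condition of the estimate. The summand 1 keeps \<rho> positive
    even if every hop has length 0.\<close>
  define \<rho> where "\<rho> = pi / 2 * (\<Sum>q\<in>Q. hop_length q) + 1"
  have \<rho>: "1 \<le> \<rho>" by (simp add: \<rho>_def sum_nonneg hop_length_nonneg)
  have ev_a: "\<forall>\<^sub>F a in lattice_spacings t. 0 < a \<and> t / a \<in> \<nat>"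
    unfolding lattice_spacings_def eventually_at_filter by simp
  have ev_L: "\<forall>\<^sub>F a in lattice_spacings t. 1 \<le> \<Lambda> a"
    using assms(3) by (simp add: filterlim_at_top)
  have ev_small: "\<forall>\<^sub>F a in lattice_spacings t. (\<Lambda> a)\<^sup>2 * a < 1 / \<rho>"
    using assms(4) \<rho> by (intro order_tendstoD) auto
  have "\<forall>\<^sub>F a in lattice_spacings t. cutoff_norm (\<Lambda> a)
            (\<lambda>\<psi> x. op_exp (- \<i> * of_real t) (hamiltonian Q A) \<psi> x
                     - (continuum_walk Q A a ^^ nat \<lfloor>t / a\<rfloor>) \<psi> x)
      \<le> ennreal (K * ((\<Lambda> a)\<^sup>2 * a))"
    using ev_a ev_L ev_small
  proof eventually_elim
    case (elim a)
    then obtain N where N: "t / a = of_nat N" by (auto elim: Nats_cases)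
    have t: "real N * a = t" using N elim by (simp add: field_simps)
    have N0: "0 < N" using t assms(2) by (cases N) auto
    have nat: "nat \<lfloor>t / a\<rfloor> = N" by (simp add: N)
    have "\<Lambda> a \<le> (\<Lambda> a)\<^sup>2" using elim by (simp add: power2_eq_square)
    then have "\<Lambda> a * a \<le> (\<Lambda> a)\<^sup>2 * a" using elim by (intro mult_right_mono) auto
    then have "\<Lambda> a * a * \<rho> \<le> (\<Lambda> a)\<^sup>2 * a * \<rho>" by (rule mult_right_mono) (use \<rho> in simp)
    moreover have "(\<Lambda> a)\<^sup>2 * a * \<rho> \<le> 1" using elim \<rho> by (simp add: field_simps)
    ultimately have "\<Lambda> a * a * \<rho> \<le> 1" by linarith
    moreover have "0 \<le> \<Lambda> a * a" using elim by simp
    ultimately have "\<Lambda> a * (pi / 2) * a * (\<Sum>q\<in>Q. hop_length q) \<le> 1"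
      by (simp add: \<rho>_def algebra_simps)
    then show ?case
      unfolding nat K_def using elim by (intro cutoff_norm_evolution_diff_le assms(1) t N0) auto
  qed
  moreover have "((\<lambda>a. ennreal (K * ((\<Lambda> a)\<^sup>2 * a))) \<longlongrightarrow> 0) (lattice_spacings t)"
    using tendsto_ennrealI[OF tendsto_mult_right_zero[OF assms(4), of K]] by simp
  ultimately show ?thesis
    by (rule tendsto_sandwich[OF always_eventually _ tendsto_const, rotated]) simp
qed

end
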